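(* Let $T>0$, $a>0$, $\varphi\in C_b(\mathbb{R}^N)$, let the coefficients of $A$ satisfy the assumptions (H1)--(H5) of the context, and let $\psi$ be as in the context. If the problem $$D_tv(t,x)+Av(t,x)=\psi(x,G(x)\nabla v(t,x)),\ t<T,\ x\in\mathbb{R}^N,\qquad v(T,x)=\varphi(x),\ x\in\mathbb{R}^N,$$ admits a mild solution in $\mathcal K_a$, then it is unique (in $\mathcal K_a$).
   Context: Notation: $N\ge1$; $|\cdot|$ is the Euclidean norm of vectors and the operator norm of matrices; $\|\cdot\|_\infty$ is the sup norm; $C_b$ denotes bounded continuous real functions; $C^{0,1}$ denotes continuous functions with continuous spatial gradient; $D_i$ denotes $\partial/\partial x_i$, acting entrywise on matrices; $\nabla$ is the gradient in $x$. For every $x\in\mathbb{R}^N$, $Q(x)=(Q_{ij}(x))$ is a symmetric positive definite $N\times N$ matrix, $G(x)=\sqrt{Q(x)}$ is its positive definite square root, $B=(B_1,\dots,B_N):\mathbb{R}^N\to\mathbb{R}^N$, $DB$ is the matrix with entries $(DB)_{ij}=D_iB_j$, and $$Af(x)=\tfrac12\mathrm{Tr}[Q(x)D^2_xf(x)]+\langle B(x),\nabla f(x)\rangle .$$ Set, for $i=1,\dots,N$, $x\in\mathbb{R}^N$, $\gamma\ge0$, $R\ge1$ (with $0^0=1$), $$f_i(x)=\Big|\sum_{j=1}^NQ_{ij}(x)(D_jG(x))G^{-1}(x)\Big|,\quad h(x)^\gamma=\sum_{j,k,l,m=1}^N|G_{jk}(x)D_kG_{lm}(x)|^\gamma,\quad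 l^i_R(x)=\frac1{1+R^2}\Big|\sum_{j=1}^NQ_{ij}(x)x_j\Big|$$ ($h(x)^\gamma$ is just notation for the displayed sum). Assumptions on the coefficients: (H1) $B_i\in C^1(\mathbb{R}^N)$, $Q_{ij}\in C^2(\mathbb{R}^N)$ for all $i,j$. (H2) There are a positive function $\nu$ and a constant $\nu_0>0$ with $\nu(x)\ge\nu_0$ and $\langle Q(x)\xi,\xi\rangle\ge\nu(x)|\xi|^2$ for all $x,\xi\in\mathbb{R}^N$; and $\langle DB(x)\xi,\xi\rangle\le0$ for all $x,\xi\in\mathbb{R}^N$. (H3) There are a positive function $b$ and a constant $b_0>0$ such that $-M(x)\ge b(x)\ge b_0$, i.e. $-\langle M(x)\xi,\xi\rangle\ge b(x)|\xi|^2$ for all $x,\xi$ and $b(x)\ge b_0$, where $$M=G(DB)G^{-1}-\sum_{i,j=1}^NQ_{ij}(D_{ij}G)G^{-1}-\sum_{j=1}^NB_j(D_jG)G^{-1}.$$ (H4) There are positive constants $K_1,\dots,K_7$, $C_n$ ($n\in\mathbb{N}$), and $\delta\in[0,3/2]$, $\alpha,\beta\in[0,2]$ such that $$\max_{j}\Big|\sum_{i=1}^NQ_{ij}(x)x_i\Big|^\delta\le K_1(1+|x|^2)^\delta\nu(x),\quad x\in\mathbb{R}^N;$$ $$K_2\sum_{j=1}^N|Q_{ij}(x)x_i|\,l^j_R(x)^{3-2\delta}+4|x_i|f_i(x)+x_iB_i(x)\le K_3(1+|x|^2),\quad i=1,\dots,N,\ |x|\le R,\ R\ge1;$$ $$K_4\Big[\Big(\frac{\langle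 Q(x)x,x\rangle}{1+|x|^4}\Big)^2+\Big(\frac{\mathrm{Tr}(Q(x))}{1+|x|^2}\Big)^2\Big]-b(x)\le K_5,\quad x\in\mathbb{R}^N;$$ $$n\Big(\sum_{i=1}^Nf_i(x)^\alpha+h(x)^\beta\Big)-b(x)\le C_n,\quad x\in\mathbb{R}^N,\ n\in\mathbb{N};$$ $$f_i(x)^{2-\alpha}\le K_6\nu(x)\ (i=1,\dots,N),\qquad h(x)^{2-\beta}\le K_7\nu(x),\quad x\in\mathbb{R}^N.$$ (H5) There are $\lambda>0$ and $f\in C^2(\mathbb{R}^N)$ with $\lim_{|x|\to\infty}f(x)=+\infty$ and $\sup_{x\in\mathbb{R}^N}(Af(x)-\lambda f(x))<\infty$. Semigroup: under these assumptions, for $\varphi\in C_b(\mathbb{R}^N)$ the problem $D_tu=Au$ for $t>0$, $u(0,\cdot)=\varphi$, has a unique classical solution $u\in C_b([0,\infty)\times\mathbb{R}^N)\cap C^{1,2}((0,\infty)\times\mathbb{R}^N)$, and $S(t)\varphi(x):=u(t,x)$ defines a contraction semigroup of linear operators on $C_b(\mathbb{R}^N)$. Nonlinearity: $\psi:\mathbb{R}^N\times\mathbb{R}^N\to\mathbb{R}$ is continuous and, for some $L_\psi>0$ and all $x,x_1,x_2,y_1,y_2\in\mathbb{R}^N$, $$|\psi(x_1,x_2)-\psi(y_1,y_2)|\le L_\psi|x_2-y_2|+L_\psi|x_1-y_1|(1+|x_2|+|y_2|),\qquad|\psi(x,0)|\le L_\psi .$$ Spaces: for $a>0$, $\mathcal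 K_a$ is the set of $h\in C_b([T-a,T]\times\mathbb{R}^N)\cap C^{0,1}([T-a,T)\times\mathbb{R}^N)$ with $[h]_{\mathcal K_a}:=\sup_{t\in[T-a,T)}(T-t)^{1/2}\|G\nabla h(t,\cdot)\|_\infty<\infty$, normed by $\|h\|_{\mathcal K_a}=\|h\|_\infty+[h]_{\mathcal K_a}$. Mild solution: with $F(t,u)(x)=\psi(x,G(x)\nabla u(t,x))$, a mild solution in $\mathcal K_a$ is a function $v\in\mathcal K_a$ with $$v(t,x)=S(T-t)\varphi(x)-\int_t^TS(r-t)F(r,v)(x)\,dr,\qquad t\in[T-a,T],\ x\in\mathbb{R}^N.$$ *)

theory Defs
  imports "HOL-Analysis.Analysis"
begin

definition partial_deriv :: "'n \<Rightarrow> (real^'n \<Rightarrow> real) \<Rightarrow> real^'n \<Rightarrow> real" where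
  "partial_deriv i f x = frechet_derivative f (at x) (axis i 1)"

definition grad :: "(real^'n \<Rightarrow> real) \<Rightarrow> real^'n \<Rightarrow> real^'n" where
  "grad f x = (\<chi> i. partial_deriv i f x)"

definition hessian :: "(real^'n \<Rightarrow> real) \<Rightarrow> real^'n \<Rightarrow> real^'n^'n" where
  "hessian f x = (\<chi> i j. partial_deriv i (partial_deriv j f) x)"

definition C1 :: "(real^'n \<Rightarrow> real) \<Rightarrow> bool" where
  "C1 f \<longleftrightarrow> (\<forall>x. f differentiable (at x)) \<and> (\<forall>i. continuous_on UNIV (partial_deriv i f))"

definition C2 :: "(real^'n \<Rightarrow> real) \<Rightarrow> bool" where
  "C2 f \<longleftrightarrow> C1 f \<and> (\<forall>i. C1 (partial_deriv i f))"

definition mat_partial :: "'n \<Rightarrow> (real^'n \<Rightarrow> real^'n^'n) \<Rightarrow> real^'n \<Rightarrow> real^'n^'n" where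
  "mat_partial i F x = (\<chi> l m. partial_deriv i (\<lambda>y. F y $ l $ m) x)"

definition mat_norm :: "real^'n^'n \<Rightarrow> real" where
  "mat_norm A = onorm (\<lambda>v. A *v v)"

definition sym_pos_def :: "real^'n^'n \<Rightarrow> bool" where
  "sym_pos_def A \<longleftrightarrow> transpose A = A \<and> (\<forall>\<xi>. \<xi> \<noteq> 0 \<longrightarrow> 0 < (A *v \<xi>) \<bullet> \<xi>)"

(* The square root is characterised, not constructed: a symmetric positive definite matrix
   has exactly one symmetric positive definite square root. *)
definition pos_def_sqrt :: "real^'n^'n \<Rightarrow> real^'n^'n \<Rightarrow> bool" where
  "pos_def_sqrt A S \<longleftrightarrow> sym_pos_def S \<and> S ** S = A"

(* Real power of a nonnegative base with 0^0 = 1; powr itself has 0 powr 0 = 0. *)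
definition rpow :: "real \<Rightarrow> real \<Rightarrow> real" where
  "rpow x \<gamma> = (if \<gamma> = 0 then 1 else x powr \<gamma>)"

definition gen_op ::
  "(real^'n \<Rightarrow> real^'n^'n) \<Rightarrow> (real^'n \<Rightarrow> real^'n) \<Rightarrow> (real^'n \<Rightarrow> real) \<Rightarrow> real^'n \<Rightarrow> real" where
  "gen_op Q B f x = 1/2 * trace (Q x ** hessian f x) + B x \<bullet> grad f x"

(* The matrix with (i,j) entry D_i B_j, i.e. the transpose of the Jacobian matrix of B. *)
definition DB :: "(real^'n \<Rightarrow> real^'n) \<Rightarrow> real^'n \<Rightarrow> real^'n^'n" where
  "DB B x = (\<chi> i j. partial_deriv i (\<lambda>y. B y $ j) x)"

definition f_coef ::
  "(real^'n \<Rightarrow> real^'n^'n) \<Rightarrow> (real^'n \<Rightarrow> real^'n^'n) \<Rightarrow> 'n \<Rightarrow> real^'n \<Rightarrow> real" where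
  "f_coef Q G i x =
     mat_norm (\<Sum>j\<in>UNIV. (Q x $ i $ j) *\<^sub>R (mat_partial j G x ** matrix_inv (G x)))"

(* h_pow G gamma x is the quantity written h(x)^gamma; it is not a power of a function h. *)
definition h_pow :: "(real^'n \<Rightarrow> real^'n^'n) \<Rightarrow> real \<Rightarrow> real^'n \<Rightarrow> real" where
  "h_pow G \<gamma> x = (\<Sum>j\<in>UNIV. \<Sum>k\<in>UNIV. \<Sum>l\<in>UNIV. \<Sum>m\<in>UNIV.
     rpow \<bar>G x $ j $ k * partial_deriv k (\<lambda>y. G y $ l $ m) x\<bar> \<gamma>)"

definition l_coef :: "(real^'n \<Rightarrow> real^'n^'n) \<Rightarrow> 'n \<Rightarrow> real \<Rightarrow> real^'n \<Rightarrow> real" where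
  "l_coef Q i R x = 1 / (1 + R^2) * \<bar>\<Sum>j\<in>UNIV. Q x $ i $ j * x $ j\<bar>"

definition M_mat ::
  "(real^'n \<Rightarrow> real^'n^'n) \<Rightarrow> (real^'n \<Rightarrow> real^'n^'n) \<Rightarrow> (real^'n \<Rightarrow> real^'n)
    \<Rightarrow> real^'n \<Rightarrow> real^'n^'n" where
  "M_mat Q G B x =
     G x ** DB B x ** matrix_inv (G x)
     - (\<Sum>i\<in>UNIV. \<Sum>j\<in>UNIV.
          (Q x $ i $ j) *\<^sub>R (mat_partial i (mat_partial j G) x ** matrix_inv (G x)))
     - (\<Sum>j\<in>UNIV. (B x $ j) *\<^sub>R (mat_partial j G x ** matrix_inv (G x)))"

definition H1 :: "(real^'n \<Rightarrow> real^'n^'n) \<Rightarrow> (real^'n \<Rightarrow> real^'n) \<Rightarrow> bool" where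
  "H1 Q B \<longleftrightarrow> (\<forall>i. C1 (\<lambda>x. B x $ i)) \<and> (\<forall>i j. C2 (\<lambda>x. Q x $ i $ j))"

definition H2 ::
  "(real^'n \<Rightarrow> real^'n^'n) \<Rightarrow> (real^'n \<Rightarrow> real^'n) \<Rightarrow> (real^'n \<Rightarrow> real) \<Rightarrow> bool" where
  "H2 Q B \<nu> \<longleftrightarrow>
     (\<exists>\<nu>0>0. \<forall>x. \<nu> x \<ge> \<nu>0) \<and>
     (\<forall>x \<xi>. (Q x *v \<xi>) \<bullet> \<xi> \<ge> \<nu> x * (norm \<xi>)^2) \<and>
     (\<forall>x \<xi>. (DB B x *v \<xi>) \<bullet> \<xi> \<le> 0)"

definition H3 ::
  "(real^'n \<Rightarrow> real^'n^'n) \<Rightarrow> (real^'n \<Rightarrow> real^'n^'n) \<Rightarrow> (real^'n \<Rightarrow> real^'n)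
    \<Rightarrow> (real^'n \<Rightarrow> real) \<Rightarrow> bool" where
  "H3 Q G B b \<longleftrightarrow>
     (\<exists>b0>0. \<forall>x. b x \<ge> b0) \<and>
     (\<forall>x \<xi>. - ((M_mat Q G B x *v \<xi>) \<bullet> \<xi>) \<ge> b x * (norm \<xi>)^2)"

definition H4 ::
  "(real^'n \<Rightarrow> real^'n^'n) \<Rightarrow> (real^'n \<Rightarrow> real^'n^'n) \<Rightarrow> (real^'n \<Rightarrow> real^'n)
    \<Rightarrow> (real^'n \<Rightarrow> real) \<Rightarrow> (real^'n \<Rightarrow> real) \<Rightarrow> bool" where
  "H4 Q G B \<nu> b \<longleftrightarrow>
     (\<exists>K1 K2 K3 K4 K5 K6 K7 (C :: nat \<Rightarrow> real) \<delta> \<alpha> \<beta>.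
        K1 > 0 \<and> K2 > 0 \<and> K3 > 0 \<and> K4 > 0 \<and> K5 > 0 \<and> K6 > 0 \<and> K7 > 0 \<and> (\<forall>n. C n > 0) \<and>
        \<delta> \<in> {0..3/2} \<and> \<alpha> \<in> {0..2} \<and> \<beta> \<in> {0..2} \<and>
        (\<forall>x. Max (range (\<lambda>j. rpow \<bar>\<Sum>i\<in>UNIV. Q x $ i $ j * x $ i\<bar> \<delta>))
               \<le> K1 * rpow (1 + (norm x)^2) \<delta> * \<nu> x) \<and>
        (\<forall>i x. \<forall>R\<ge>1. norm x \<le> R \<longrightarrow>
             K2 * (\<Sum>j\<in>UNIV. \<bar>Q x $ i $ j * x $ i\<bar> * rpow (l_coef Q j R x) (3 - 2 * \<delta>))
             + 4 * \<bar>x $ i\<bar> * f_coef Q G i x + x $ i * B x $ i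
               \<le> K3 * (1 + (norm x)^2)) \<and>
        (\<forall>x. K4 * ((((Q x *v x) \<bullet> x) / (1 + (norm x)^4))^2
                    + (trace (Q x) / (1 + (norm x)^2))^2) - b x \<le> K5) \<and>
        (\<forall>x n. real n * ((\<Sum>i\<in>UNIV. rpow (f_coef Q G i x) \<alpha>) + h_pow G \<beta> x) - b x \<le> C n) \<and>
        (\<forall>i x. rpow (f_coef Q G i x) (2 - \<alpha>) \<le> K6 * \<nu> x) \<and>
        (\<forall>x. h_pow G (2 - \<beta>) x \<le> K7 * \<nu> x))"

definition H5 :: "(real^'n \<Rightarrow> real^'n^'n) \<Rightarrow> (real^'n \<Rightarrow> real^'n) \<Rightarrow> bool" where
  "H5 Q B \<longleftrightarrow>
     (\<exists>c>0. \<exists>f. C2 f \<and> filterlim f at_top at_infinity \<and>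
        bdd_above (range (\<lambda>x. gen_op Q B f x - c * f x)))"

(* Bounded classical solution of D_t u = A u for t > 0, u(0,.) = phi, in the class
   C_b([0,oo) x R^N) and C^{1,2}((0,oo) x R^N); u t x is read only for t >= 0. *)
definition classical_solution ::
  "(real^'n \<Rightarrow> real^'n^'n) \<Rightarrow> (real^'n \<Rightarrow> real^'n) \<Rightarrow> (real^'n \<Rightarrow> real)
    \<Rightarrow> (real \<Rightarrow> real^'n \<Rightarrow> real) \<Rightarrow> bool" where
  "classical_solution Q B \<phi> u \<longleftrightarrow>
     continuous_on ({0..} \<times> UNIV) (\<lambda>(t, x). u t x) \<and>
     bounded ((\<lambda>(t, x). u t x) ` ({0..} \<times> UNIV)) \<and>
     (\<forall>t>0. \<forall>x. (\<lambda>s. u s x) field_differentiable (at t)) \<and>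
     continuous_on ({0<..} \<times> UNIV) (\<lambda>(t, x). deriv (\<lambda>s. u s x) t) \<and>
     (\<forall>t>0. C2 (u t)) \<and>
     continuous_on ({0<..} \<times> UNIV) (\<lambda>(t, x). grad (u t) x) \<and>
     continuous_on ({0<..} \<times> UNIV) (\<lambda>(t, x). hessian (u t) x) \<and>
     (\<forall>t>0. \<forall>x. deriv (\<lambda>s. u s x) t = gen_op Q B (u t) x) \<and>
     (\<forall>x. u 0 x = \<phi> x)"

(* S t phi is the value at time t of the classical solution with bounded continuous datum phi.
   Nothing is required of S at other data or at negative times. *)
definition semigroup_of ::
  "(real^'n \<Rightarrow> real^'n^'n) \<Rightarrow> (real^'n \<Rightarrow> real^'n)
    \<Rightarrow> (real \<Rightarrow> (real^'n \<Rightarrow> real) \<Rightarrow> real^'n \<Rightarrow> real) \<Rightarrow> bool" where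
  "semigroup_of Q B S \<longleftrightarrow> (\<forall>\<phi>\<in>bcontfun. classical_solution Q B \<phi> (\<lambda>t. S t \<phi>))"

definition admissible_nonlinearity :: "(real^'n \<Rightarrow> real^'n \<Rightarrow> real) \<Rightarrow> bool" where
  "admissible_nonlinearity \<psi> \<longleftrightarrow>
     continuous_on UNIV (\<lambda>(x, y). \<psi> x y) \<and>
     (\<exists>L>0.
        (\<forall>x1 x2 y1 y2. \<bar>\<psi> x1 x2 - \<psi> y1 y2\<bar>
            \<le> L * norm (x2 - y2) + L * norm (x1 - y1) * (1 + norm x2 + norm y2)) \<and>
        (\<forall>x. \<bar>\<psi> x 0\<bar> \<le> L))"

definition K_space ::
  "(real^'n \<Rightarrow> real^'n^'n) \<Rightarrow> real \<Rightarrow> real \<Rightarrow> (real \<Rightarrow> real^'n \<Rightarrow> real) set" where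
  "K_space G T a = {h.
     continuous_on ({T - a..T} \<times> UNIV) (\<lambda>(t, x). h t x) \<and>
     bounded ((\<lambda>(t, x). h t x) ` ({T - a..T} \<times> UNIV)) \<and>
     (\<forall>t\<in>{T - a..<T}. \<forall>x. h t differentiable (at x)) \<and>
     continuous_on ({T - a..<T} \<times> UNIV) (\<lambda>(t, x). grad (h t) x) \<and>
     bdd_above ((\<lambda>(t, x). sqrt (T - t) * norm (G x *v grad (h t) x)) ` ({T - a..<T} \<times> UNIV))}"

definition nonlin ::
  "(real^'n \<Rightarrow> real^'n^'n) \<Rightarrow> (real^'n \<Rightarrow> real^'n \<Rightarrow> real) \<Rightarrow> real
    \<Rightarrow> (real \<Rightarrow> real^'n \<Rightarrow> real) \<Rightarrow> real^'n \<Rightarrow> real" where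
  "nonlin G \<psi> t u = (\<lambda>x. \<psi> x (G x *v grad (u t) x))"

(* At r = T the gradient of v, hence the integrand, may be meaningless; this is a null set. *)
definition mild_solution ::
  "(real \<Rightarrow> (real^'n \<Rightarrow> real) \<Rightarrow> real^'n \<Rightarrow> real) \<Rightarrow> (real^'n \<Rightarrow> real^'n^'n)
    \<Rightarrow> (real^'n \<Rightarrow> real^'n \<Rightarrow> real) \<Rightarrow> (real^'n \<Rightarrow> real) \<Rightarrow> real \<Rightarrow> real
    \<Rightarrow> (real \<Rightarrow> real^'n \<Rightarrow> real) \<Rightarrow> bool" where
  "mild_solution S G \<psi> \<phi> T a v \<longleftrightarrow>
     v \<in> K_space G T a \<and>
     (\<forall>t\<in>{T - a..T}. \<forall>x.
        v t x = S (T - t) \<phi> x - (LINT r:{t..T}|lborel. S (r - t) (nonlin G \<psi> r v) x))"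

end

theory Submission
  imports Defs
begin

text \<open>
Uniqueness is a maximum principle for the difference \<open>z = w - v\<close> of two mild solutions.
Subtracting the two mild equations gives
\<open>z(t) = \<integral>\<^sub>t\<^sup>T S(r - t) g\<^sub>r dr\<close> with
\<open>g\<^sub>r = \<psi>(\<cdot>, G\<nabla>v(r)) - \<psi>(\<cdot>, G\<nabla>w(r))\<close>, so formally
\<open>D\<^sub>t z + A z = - g\<close>, \<open>z(T) = 0\<close>, and the Lipschitz condition bounds the source by the
gradient of \<open>z\<close> itself: \<open>\<bar>g\<bar> \<le> L \<bar>G\<nabla>z\<bar>\<close>. It is shown that \<open>z \<le> 0\<close>; exchanging
\<open>v\<close> and \<open>w\<close> gives \<open>z = 0\<close>.

The space is not compact, so the maximum principle needs a penalty that tends to infinity and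
absorbs the term \<open>L \<bar>G\<nabla>z\<bar>\<close>. The Lyapunov function \<open>f\<close> of (H5) does not do this, because
nothing controls \<open>G\<nabla>f\<close>, but its logarithm does: for \<open>F = ln (f + const)\<close> the second derivative
of \<open>ln\<close> contributes \<open>- \<bar>G\<nabla>F\<bar>\<^sup>2 / 2\<close> to \<open>A F\<close>, whence
\<open>A F + L \<bar>G\<nabla>F\<bar> \<le> K + L\<^sup>2 / 2\<close> everywhere (\<open>log_lyapunov\<close>).

Since \<open>z\<close> has only first derivatives in space, the argument at the maximum point
\<open>(t\<^sub>0, x\<^sub>0)\<close> of \<open>z - \<epsilon> (F + K' (T - t))\<close> is the one for viscosity solutions
(\<open>mild_comparison\<close>). There \<open>\<nabla>z = \<epsilon> \<nabla>F\<close>, and instead of differentiating \<open>z\<close> twice one uses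
the identity \<open>z(t\<^sub>0) = \<integral> S(r - t\<^sub>0) g\<^sub>r dr + S(h) z(t\<^sub>0 + h)\<close>, the integral being over
\<open>[t\<^sub>0, t\<^sub>0 + h]\<close> (\<open>mild_integral_split\<close>), together with the short-time bound
\<open>S(h) \<phi> (x\<^sub>0) \<le> m + \<epsilon> (F(x\<^sub>0) + h (A F(x\<^sub>0) + \<kappa>))\<close> for all \<open>\<phi> \<le> m + \<epsilon> F\<close>
(\<open>S_local_generator\<close>). Dividing by \<open>h\<close> yields \<open>K' \<le> A F + L \<bar>G\<nabla>F\<bar> + 1/2\<close> at \<open>x\<^sub>0\<close>,
which is false for \<open>K' = K + L\<^sup>2 / 2 + 1\<close>. Hence \<open>z \<le> \<epsilon> (F + K' (T - t))\<close> for every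
\<open>\<epsilon> > 0\<close>.

The identity for \<open>z\<close> requires that \<open>S(h)\<close> commutes with the integral (\<open>S_integral\<close>).
This rests on tightness (\<open>S_tight\<close>): on bounded sets of functions, \<open>S(h)\<close> is continuous with
respect to locally uniform convergence. Tightness, contractivity,
linearity and the semigroup law all come from the classical parabolic maximum principle with
penalty \<open>F\<close> (\<open>max_principle\<close>).
\<close>

section \<open>Calculus of partial derivatives\<close>

lemma partial_deriv_eqI:
  assumes "(f has_derivative f') (at x)"
  shows "partial_deriv i f x = f' (axis i 1)"
  using frechet_derivative_at[OF assms] by (simp add: partial_deriv_def)

lemma has_derivative_grad:
  fixes f :: "real^'n \<Rightarrow> real"
  assumes "f differentiable (at x)"
  shows "(f has_derivative (\<lambda>h. grad f x \<bullet> h)) (at x)"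
proof -
  from assms obtain f' where f': "(f has_derivative f') (at x)"
    unfolding differentiable_def by blast
  interpret bounded_linear f' using f' by (rule has_derivative_bounded_linear)
  have "f' h = grad f x \<bullet> h" for h
  proof -
    have "f' h = f' (\<Sum>i\<in>UNIV. h $ i *\<^sub>R axis i 1)"
      using basis_expansion[of h] by (simp add: scalar_mult_eq_scaleR)
    also have "\<dots> = (\<Sum>i\<in>UNIV. h $ i * f' (axis i 1))"
      by (simp add: sum scaleR)
    finally show ?thesis
      by (simp add: grad_def inner_vec_def partial_deriv_eqI[OF f'] mult.commute)
  qed
  then show ?thesis using f' by (metis (no_types, lifting) ext)
qed

lemma grad_eqI:
  fixes f :: "real^'n \<Rightarrow> real"
  assumes "(f has_derivative (\<lambda>h. g \<bullet> h)) (at x)"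
  shows "grad f x = g"
  by (simp add: grad_def vec_eq_iff partial_deriv_eqI[OF assms] inner_axis)

lemma grad_nth [simp]: "grad f x $ i = partial_deriv i f x"
  by (simp add: grad_def)

lemma C1D:
  assumes "C1 f"
  shows "f differentiable (at x)" "continuous_on UNIV f" "continuous_on UNIV (partial_deriv i f)"
  using assms unfolding C1_def
  by (auto intro!: differentiable_imp_continuous_on simp: differentiable_on_def
      intro: differentiable_at_withinI)

lemma C1I:
  fixes f :: "real^'n \<Rightarrow> real"
  assumes "\<And>x. (f has_derivative (\<lambda>h. g x \<bullet> h)) (at x)" "\<And>i. continuous_on UNIV (\<lambda>x. g x $ i)"
  shows "C1 f" "partial_deriv i f = (\<lambda>x. g x $ i)"
proof -
  have *: "partial_deriv i f = (\<lambda>x. g x $ i)" for i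
    using grad_eqI[OF assms(1)] by (metis grad_nth)
  show "C1 f" unfolding C1_def * using assms by (auto simp: differentiable_def)
  show "partial_deriv i f = (\<lambda>x. g x $ i)" by (rule *)
qed

lemma C1_const: "C1 (\<lambda>_. c)" "partial_deriv i (\<lambda>_. c) = (\<lambda>_. 0)"
  using C1I[of "\<lambda>_. c" "\<lambda>_. 0"] by (auto simp: continuous_on_const)

lemma C1_lincomb:
  assumes "C1 f" "C1 g"
  shows "C1 (\<lambda>x. f x + c * g x)"
    "partial_deriv i (\<lambda>x. f x + c * g x) = (\<lambda>x. partial_deriv i f x + c * partial_deriv i g x)"
proof -
  have d: "((\<lambda>x. f x + c * g x) has_derivative (\<lambda>h. (grad f x + c *\<^sub>R grad g x) \<bullet> h)) (at x)" for x
    by (rule derivative_eq_intros has_derivative_grad C1D assms refl)+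
       (auto simp: algebra_simps inner_left_distrib)
  have c: "continuous_on UNIV (\<lambda>x. (grad f x + c *\<^sub>R grad g x) $ i)" for i
    by (simp, intro continuous_intros C1D assms)
  show "C1 (\<lambda>x. f x + c * g x)" by (rule C1I[OF d c])
  show "partial_deriv i (\<lambda>x. f x + c * g x) = (\<lambda>x. partial_deriv i f x + c * partial_deriv i g x)"
    using C1I(2)[OF d c] by simp
qed

lemma C1_mult:
  assumes "C1 f" "C1 g"
  shows "C1 (\<lambda>x. f x * g x)"
    "partial_deriv i (\<lambda>x. f x * g x) = (\<lambda>x. f x * partial_deriv i g x + partial_deriv i f x * g x)"
proof -
  have d: "((\<lambda>x. f x * g x) has_derivative (\<lambda>h. (f x *\<^sub>R grad g x + g x *\<^sub>R grad f x) \<bullet> h)) (at x)" for x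
    by (rule derivative_eq_intros has_derivative_grad C1D assms refl)+
       (auto simp: algebra_simps inner_left_distrib)
  have c: "continuous_on UNIV (\<lambda>x. (f x *\<^sub>R grad g x + g x *\<^sub>R grad f x) $ i)" for i
    by (simp, intro continuous_intros C1D assms)
  show "C1 (\<lambda>x. f x * g x)" by (rule C1I[OF d c])
  show "partial_deriv i (\<lambda>x. f x * g x) = (\<lambda>x. f x * partial_deriv i g x + partial_deriv i f x * g x)"
    using C1I(2)[OF d c] by (simp add: mult.commute)
qed

lemma C1_compose:
  assumes "C1 f" "\<And>x. (h has_real_derivative h1 (f x)) (at (f x))"
    and "continuous_on (range f) h1"
  shows "C1 (\<lambda>x. h (f x))"
    "partial_deriv i (\<lambda>x. h (f x)) = (\<lambda>x. h1 (f x) * partial_deriv i f x)"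
proof -
  have d: "((\<lambda>x. h (f x)) has_derivative (\<lambda>k. (h1 (f x) *\<^sub>R grad f x) \<bullet> k)) (at x)" for x
  proof -
    have h: "(h has_derivative (\<lambda>y. h1 (f x) * y)) (at (f x))"
      using assms(2)[of x] by (simp add: has_field_derivative_def)
    show ?thesis
      using has_derivative_compose[OF has_derivative_grad[OF C1D(1)[OF assms(1)]] h]
      by simp
  qed
  have hc: "continuous_on UNIV (\<lambda>x. h1 (f x))"
    by (rule continuous_on_compose2[OF assms(3) C1D(2)[OF assms(1)]]) auto
  have c: "continuous_on UNIV (\<lambda>x. (h1 (f x) *\<^sub>R grad f x) $ i)" for i
    by (simp, intro continuous_intros C1D assms hc)
  show "C1 (\<lambda>x. h (f x))" by (rule C1I[OF d c])
  show "partial_deriv i (\<lambda>x. h (f x)) = (\<lambda>x. h1 (f x) * partial_deriv i f x)"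
    using C1I(2)[OF d c] by simp
qed

lemma C2D:
  assumes "C2 f"
  shows "C1 f" "C1 (partial_deriv i f)"
    "f differentiable (at x)" "continuous_on UNIV f" "continuous_on UNIV (partial_deriv i f)"
    "continuous_on UNIV (partial_deriv i (partial_deriv j f))"
  using assms C1D unfolding C2_def by blast+

lemma gen_op_expand:
  "gen_op Q B f x = 1/2 * (\<Sum>i\<in>UNIV. \<Sum>j\<in>UNIV. Q x $ i $ j * partial_deriv j (partial_deriv i f) x)
     + (\<Sum>i\<in>UNIV. B x $ i * partial_deriv i f x)"
  by (simp add: gen_op_def trace_def matrix_matrix_mult_def hessian_def inner_vec_def)

lemma C2_const: "C2 (\<lambda>_. c)" "gen_op Q B (\<lambda>_. c) x = 0"
  by (simp_all add: C2_def C1_const gen_op_expand)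

lemma C2_lincomb:
  assumes "C2 f" "C2 g"
  shows "C2 (\<lambda>x. f x + c * g x)"
    "gen_op Q B (\<lambda>x. f x + c * g x) x = gen_op Q B f x + c * gen_op Q B g x"
proof -
  note c1 = C1_lincomb[OF C2D(1)[OF assms(1)] C2D(1)[OF assms(2)]]
  note c2 = C1_lincomb[OF C2D(2)[OF assms(1)] C2D(2)[OF assms(2)]]
  show "C2 (\<lambda>x. f x + c * g x)"
    unfolding C2_def c1(2) by (intro conjI allI c1(1) c2(1))
  show "gen_op Q B (\<lambda>x. f x + c * g x) x = gen_op Q B f x + c * gen_op Q B g x"
    unfolding gen_op_expand c1(2) c2(2)
    by (simp add: algebra_simps sum.distrib sum_distrib_left)
qed

text \<open>The quadratic term \<open>h'' \<langle>Q \<nabla>f, \<nabla>f\<rangle> / 2\<close> is what makes the logarithm of a Lyapunov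
function better than the function itself: there \<open>h''\<close> is negative.\<close>

lemma C2_compose:
  fixes f :: "real^'n \<Rightarrow> real"
  assumes f: "C2 f" and h: "\<And>x. (h has_real_derivative h1 (f x)) (at (f x))"
    and h1: "\<And>x. (h1 has_real_derivative h2 (f x)) (at (f x))"
    and h2: "continuous_on (range f) h2"
  shows "C2 (\<lambda>x. h (f x))"
    "gen_op Q B (\<lambda>x. h (f x)) x =
       h1 (f x) * gen_op Q B f x + 1/2 * h2 (f x) * ((Q x *v grad f x) \<bullet> grad f x)"
proof -
  have ch1: "continuous_on (range f) h1"
    by (rule continuous_at_imp_continuous_on) (auto intro: DERIV_isCont[OF h1])
  note c1 = C1_compose[OF C2D(1)[OF f] h ch1]
  note c2 = C1_compose[OF C2D(1)[OF f] h1 h2]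
  show "C2 (\<lambda>x. h (f x))"
    unfolding C2_def c1(2) by (intro conjI allI c1(1) C1_mult(1) c2(1) C2D(2)[OF f])
  show "gen_op Q B (\<lambda>x. h (f x)) x =
       h1 (f x) * gen_op Q B f x + 1/2 * h2 (f x) * ((Q x *v grad f x) \<bullet> grad f x)"
    unfolding gen_op_expand c1(2) C1_mult(2)[OF c2(1) C2D(2)[OF f]] c2(2)
    by (simp add: matrix_vector_mult_def inner_vec_def sum.distrib sum_distrib_left
        sum_distrib_right algebra_simps)
qed

lemma gen_op_continuous:
  assumes "C2 f" "\<And>i j. continuous_on UNIV (\<lambda>x. Q x $ i $ j)" "\<And>i. continuous_on UNIV (\<lambda>x. B x $ i)"
  shows "continuous_on UNIV (gen_op Q B f)"
  unfolding gen_op_expand[abs_def]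
  by (intro continuous_intros assms C2D[OF assms(1)])

text \<open>The second derivative test is applied to \<open>s \<mapsto> p (x\<^sub>0 + s \<xi>)\<close>: a positive second derivative
at the critical point 0 would make the function increase to the right of 0.\<close>

lemma hessian_nonpos_at_max:
  fixes p :: "real^'n \<Rightarrow> real"
  assumes p: "C2 p" and mx: "\<And>x. p x \<le> p x0"
  shows "\<xi> \<bullet> (hessian p x0 *v \<xi>) \<le> 0"
proof (rule ccontr)
  assume "\<not> ?thesis"
  then have pos: "\<xi> \<bullet> (hessian p x0 *v \<xi>) > 0" by simp
  define q1 where "q1 s = grad p (x0 + s *\<^sub>R \<xi>) \<bullet> \<xi>" for s
  have dq: "((\<lambda>s. p (x0 + s *\<^sub>R \<xi>)) has_real_derivative q1 s) (at s)" for s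
  proof -
    have i: "((\<lambda>s. x0 + s *\<^sub>R \<xi>) has_derivative (\<lambda>k. k *\<^sub>R \<xi>)) (at s)"
      by (auto intro!: derivative_eq_intros)
    show ?thesis
      using has_derivative_compose[OF i has_derivative_grad[OF C2D(3)[OF p]]]
      by (simp add: has_field_derivative_def q1_def mult_commute_abs)
  qed
  have dq1: "(q1 has_real_derivative \<xi> \<bullet> (hessian p x0 *v \<xi>)) (at 0)"
  proof -
    have "((\<lambda>s. partial_deriv j p (x0 + s *\<^sub>R \<xi>)) has_real_derivative
        grad (partial_deriv j p) x0 \<bullet> \<xi>) (at 0)" for j
    proof -
      have i: "((\<lambda>s. x0 + s *\<^sub>R \<xi>) has_derivative (\<lambda>k. k *\<^sub>R \<xi>)) (at 0)"
        by (auto intro!: derivative_eq_intros)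
      have "(partial_deriv j p has_derivative (\<lambda>h. grad (partial_deriv j p) x0 \<bullet> h)) (at (x0 + 0 *\<^sub>R \<xi>))"
        using has_derivative_grad[OF C1D(1)[OF C2D(2)[OF p]]] by simp
      from has_derivative_compose[OF i this] show ?thesis
        by (simp add: has_field_derivative_def mult_commute_abs)
    qed
    then have "((\<lambda>s. \<Sum>j\<in>UNIV. partial_deriv j p (x0 + s *\<^sub>R \<xi>) * \<xi> $ j) has_real_derivative
        (\<Sum>j\<in>UNIV. (grad (partial_deriv j p) x0 \<bullet> \<xi>) * \<xi> $ j)) (at 0)"
      by (intro derivative_intros DERIV_cmult_right) auto
    moreover have "(\<Sum>j\<in>UNIV. (grad (partial_deriv j p) x0 \<bullet> \<xi>) * \<xi> $ j)
        = \<xi> \<bullet> (hessian p x0 *v \<xi>)"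
      unfolding inner_vec_def matrix_vector_mult_def hessian_def grad_nth vec_lambda_beta
        inner_real_def sum_distrib_left sum_distrib_right
      by (subst sum.swap) (simp add: mult_ac)
    ultimately show ?thesis
      by (simp add: q1_def[abs_def] inner_vec_def)
  qed
  have q10: "q1 0 = 0"
  proof (rule DERIV_local_max[OF dq[of 0], of 1])
    show "\<forall>y. \<bar>0 - y\<bar> < 1 \<longrightarrow> p (x0 + y *\<^sub>R \<xi>) \<le> p (x0 + 0 *\<^sub>R \<xi>)"
      using mx by simp
  qed simp
  from DERIV_pos_inc_right[OF dq1 pos] q10 obtain d where d: "d > 0" "\<And>h. 0 < h \<Longrightarrow> h < d \<Longrightarrow> q1 h > 0"
    by auto
  obtain y where y: "0 < y" "y < d/2"
    "p (x0 + (d/2) *\<^sub>R \<xi>) - p (x0 + 0 *\<^sub>R \<xi>) = (d/2 - 0) * q1 y"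
    using MVT2[of 0 "d/2" "\<lambda>s. p (x0 + s *\<^sub>R \<xi>)" q1] d(1) dq by auto
  have "q1 y > 0" using d(2)[of y] y(1,2) d(1) by simp
  with y d(1) have "p (x0 + (d/2) *\<^sub>R \<xi>) > p x0" by (simp add: field_simps) (smt (verit) mult_pos_pos)
  with mx show False by (simp add: not_le[symmetric])
qed

lemma grad_zero_at_max:
  fixes p :: "real^'n \<Rightarrow> real"
  assumes "p differentiable (at x0)" "\<And>x. p x \<le> p x0"
  shows "grad p x0 = 0"
proof -
  have "(\<lambda>h. grad p x0 \<bullet> h) = (\<lambda>h. 0)"
    by (rule has_derivative_local_max[OF has_derivative_grad[OF assms(1)]]) (simp add: assms(2))
  then have "grad p x0 \<bullet> grad p x0 = 0" by meson
  then show ?thesis by simp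
qed

text \<open>Writing \<open>Q = G G\<close> turns \<open>Tr (Q H)\<close> into a sum of values of the quadratic form of \<open>H\<close>,
which makes its sign visible when \<open>H\<close> is semidefinite.\<close>

lemma trace_psd_square:
  fixes G H :: "real^'n^'n"
  assumes "transpose G = G"
  shows "trace ((G ** G) ** H) = (\<Sum>i\<in>UNIV. (G *v axis i 1) \<bullet> (H *v (G *v axis i 1)))"
proof -
  have s: "G $ i $ j = G $ j $ i" for i j using assms by (metis transpose_def vec_lambda_beta)
  have "trace ((G ** G) ** H) = trace (G ** (G ** H))" by (simp add: matrix_mul_assoc)
  also have "\<dots> = trace ((G ** H) ** G)" by (rule trace_mul_sym)
  also have "\<dots> = (\<Sum>i\<in>UNIV. (G ** (H ** G)) $ i $ i)"
    by (simp add: trace_def matrix_mul_assoc)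
  also have "\<dots> = (\<Sum>i\<in>UNIV. \<Sum>k\<in>UNIV. G $ i $ k * (H ** G) $ k $ i)"
    unfolding matrix_matrix_mult_def[of G "H ** G"] by simp
  also have "\<dots> = (\<Sum>i\<in>UNIV. \<Sum>k\<in>UNIV. G $ k $ i * (H ** G) $ k $ i)"
    by (intro sum.cong refl, subst s, rule refl)
  also have "\<dots> = (\<Sum>i\<in>UNIV. (G *v axis i 1) \<bullet> (H *v (G *v axis i 1)))"
    unfolding inner_vec_def
    by (subst matrix_vector_mul_assoc) (simp add: matrix_vector_mult_basis column_def)
  finally show ?thesis .
qed

lemma gen_op_le_0_at_max:
  fixes p :: "real^'n \<Rightarrow> real"
  assumes "pos_def_sqrt (Q x0) (G x0)" and p: "C2 p" and mx: "\<And>x. p x \<le> p x0"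
  shows "gen_op Q B p x0 \<le> 0"
proof -
  have G: "transpose (G x0) = G x0" "Q x0 = G x0 ** G x0"
    using assms(1) by (auto simp: pos_def_sqrt_def sym_pos_def_def)
  have "trace (Q x0 ** hessian p x0) \<le> 0"
    unfolding G(2) trace_psd_square[OF G(1)] by (intro sum_nonpos hessian_nonpos_at_max[OF p mx])
  then show ?thesis
    using grad_zero_at_max[OF C2D(3)[OF p] mx] by (simp add: gen_op_def)
qed

section \<open>The parabolic maximum principle with a Lyapunov penalty\<close>

lemma attains_max_coercive:
  fixes F :: "real^'n \<Rightarrow> real" and u :: "real \<Rightarrow> real^'n \<Rightarrow> real"
  assumes u: "continuous_on ({a..b} \<times> UNIV) (\<lambda>(t, x). u t x)" and "a \<le> b"
    and M: "\<And>t x. t \<in> {a..b} \<Longrightarrow> u t x \<le> M"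
    and F: "continuous_on UNIV F" "filterlim F at_top at_infinity" and e: "e > 0"
  obtains t0 x0 where "t0 \<in> {a..b}"
    "\<And>t x. t \<in> {a..b} \<Longrightarrow> u t x - e * F x \<le> u t0 x0 - e * F x0"
proof -
  define c where "c = u a 0 - e * F 0"
  have "eventually (\<lambda>x. F x \<ge> (M - c) / e) at_infinity"
    using F(2) by (simp add: filterlim_at_top)
  then obtain r where r: "\<And>x. norm x \<ge> r \<Longrightarrow> F x \<ge> (M - c) / e"
    unfolding eventually_at_infinity by blast
  define X where "X = {a..b} \<times> cball (0::real^'n) (max r 0)"
  have "compact X" unfolding X_def by (intro compact_Times) auto
  moreover have "(a, 0) \<in> X" using \<open>a \<le> b\<close> by (auto simp: X_def)
  moreover have "continuous_on X (\<lambda>(t, x). u t x - e * F x)"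
  proof -
    have "continuous_on X (\<lambda>(t, x). u t x)"
      by (rule continuous_on_subset[OF u]) (auto simp: X_def)
    moreover have "continuous_on X (\<lambda>p. F (snd p))"
      by (rule continuous_on_compose2[OF F(1)]) (auto intro: continuous_intros)
    ultimately show ?thesis by (auto simp: case_prod_unfold intro!: continuous_intros)
  qed
  ultimately obtain p where p: "p \<in> X"
    "\<forall>q\<in>X. (\<lambda>(t, x). u t x - e * F x) q \<le> (\<lambda>(t, x). u t x - e * F x) p"
    using continuous_attains_sup[of X] by blast
  obtain t0 x0 where tx: "p = (t0, x0)" by force
  have in_X: "u t x - e * F x \<le> u t0 x0 - e * F x0" if "(t, x) \<in> X" for t x
    using p(2) that tx by auto
  show thesis
  proof
    show "t0 \<in> {a..b}" using p(1) tx by (auto simp: X_def)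
    fix t x assume t: "t \<in> {a..b}"
    show "u t x - e * F x \<le> u t0 x0 - e * F x0"
    proof (cases "(t, x) \<in> X")
      case False
      then have "F x \<ge> (M - c) / e" using t r[of x] by (auto simp: X_def)
      then have "e * F x \<ge> M - c" using e by (simp add: field_simps)
      with M[OF t, of x] in_X[OF \<open>(a, 0) \<in> X\<close>] show ?thesis by (simp add: c_def)
    qed (rule in_X)
  qed
qed

lemma zero_bcontfun: "(\<lambda>x. 0) \<in> (bcontfun :: (real^'n \<Rightarrow> real) set)"
  by (simp add: bcontfun_def)

lemma bcontfun_lincomb:
  fixes f g :: "real^'n \<Rightarrow> real"
  assumes "f \<in> bcontfun" "g \<in> bcontfun" shows "(\<lambda>x. f x + c * g x) \<in> bcontfun"
  using plus_cont[OF assms(1) scaleR_cont[OF assms(2), of c]] by simp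

locale lyapunov =
  fixes Q G :: "real^'n \<Rightarrow> real^'n^'n" and B :: "real^'n \<Rightarrow> real^'n"
    and F :: "real^'n \<Rightarrow> real" and K :: real
  assumes sqrt_Q: "\<And>x. pos_def_sqrt (Q x) (G x)"
    and C2_F: "C2 F" and F_nonneg: "\<And>x. F x \<ge> 0" and F_coercive: "filterlim F at_top at_infinity"
    and F_super: "\<And>x. gen_op Q B F x \<le> K" and K_nonneg: "K \<ge> 0"
begin

text \<open>Otherwise \<open>u - e (F + (K + 1) t)\<close> has, for small \<open>e\<close>, a maximum above \<open>m\<close> at a positive
time; there the time derivative of \<open>u\<close> is at least \<open>e (K + 1)\<close>, while
\<open>A u \<le> e A F \<le> e K\<close>.\<close>

lemma max_principle:
  assumes u: "continuous_on ({0..\<tau>} \<times> UNIV) (\<lambda>(t, x). u t x)"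
    and M: "\<And>t x. t \<in> {0..\<tau>} \<Longrightarrow> u t x \<le> M"
    and C2: "\<And>t. t \<in> {0<..\<tau>} \<Longrightarrow> C2 (u t)"
    and du: "\<And>t x. t \<in> {0<..\<tau>} \<Longrightarrow> ((\<lambda>s. u s x) has_real_derivative u' t x) (at t)"
    and sub: "\<And>t x. t \<in> {0<..\<tau>} \<Longrightarrow> u' t x \<le> gen_op Q B (u t) x"
    and init: "\<And>x. u 0 x \<le> m" and t1: "t1 \<in> {0..\<tau>}"
  shows "u t1 x1 \<le> m"
proof (rule field_le_epsilon)
  fix d :: real assume "d > 0"
  \<comment> \<open>chosen so that the penalty at \<open>(t1, x1)\<close> is at most \<open>d\<close>\<close>
  define e where "e = d / (F x1 + (K + 1) * t1 + 1)"
  have pos: "F x1 + (K + 1) * t1 \<ge> 0" using F_nonneg[of x1] K_nonneg t1 by simp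
  have e: "e > 0" using pos \<open>d > 0\<close> by (simp add: e_def)
  define p where "p t x = u t x - e * (K + 1) * t" for t x
  have p: "continuous_on ({0..\<tau>} \<times> UNIV) (\<lambda>(t, x). p t x)"
    using u by (auto simp: p_def case_prod_unfold intro!: continuous_intros)
  have pM: "p t x \<le> M" if "t \<in> {0..\<tau>}" for t x
    using M[OF that, of x] e K_nonneg that
    by (auto simp: p_def intro!: order_trans[OF _ M[OF that, of x]] mult_nonneg_nonneg)
  have "0 \<le> \<tau>" using t1 by simp
  obtain t0 x0 where t0: "t0 \<in> {0..\<tau>}"
    and mx: "\<And>t x. t \<in> {0..\<tau>} \<Longrightarrow> p t x - e * F x \<le> p t0 x0 - e * F x0"
    using attains_max_coercive[OF p \<open>0 \<le> \<tau>\<close> pM C2D(4)[OF C2_F] F_coercive e] by blast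
  have "p t0 x0 - e * F x0 \<le> m"
  proof (cases "t0 = 0")
    case True
    moreover have "e * F x0 \<ge> 0" using e F_nonneg by simp
    ultimately show ?thesis using init[of x0] by (simp add: p_def)
  next
    case False
    then have t0': "t0 \<in> {0<..\<tau>}" using t0 by auto
    have d0: "((\<lambda>s. p s x0) has_real_derivative u' t0 x0 - e * (K + 1)) (at t0)"
      unfolding p_def by (auto intro!: derivative_eq_intros du[OF t0'])
    \<comment> \<open>\<open>t0\<close> may be the final time, so only the derivative from the left is tested\<close>
    have "u' t0 x0 - e * (K + 1) \<ge> 0"
    proof (rule ccontr)
      assume "\<not> ?thesis"
      then obtain \<delta> where \<delta>: "\<delta> > 0" "\<And>h. 0 < h \<Longrightarrow> h < \<delta> \<Longrightarrow> p t0 x0 < p (t0 - h) x0"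
        using DERIV_neg_dec_left[OF d0] by auto
      define h where "h = min (\<delta>/2) t0"
      have "p t0 x0 < p (t0 - h) x0" using \<delta> t0' by (auto simp: h_def)
      moreover have "t0 - h \<in> {0..\<tau>}" using t0' \<delta> by (auto simp: h_def)
      ultimately show False using mx[of "t0 - h" x0] by simp
    qed
    moreover have "gen_op Q B (u t0) x0 - e * gen_op Q B F x0 \<le> 0"
    proof -
      have "gen_op Q B (\<lambda>x. u t0 x + (- e) * F x) x0 \<le> 0"
      proof (rule gen_op_le_0_at_max[of Q x0 G, OF sqrt_Q])
        show "C2 (\<lambda>x. u t0 x + - e * F x)" by (rule C2_lincomb C2 t0' C2_F)+
        show "u t0 x + - e * F x \<le> u t0 x0 + - e * F x0" for x
          using mx[OF t0, of x] by (simp add: p_def)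
      qed
      then show ?thesis unfolding C2_lincomb(2)[OF C2[OF t0'] C2_F] by simp
    qed
    moreover have "e * gen_op Q B F x0 \<le> e * K" by (rule mult_left_mono) (use F_super e in auto)
    ultimately have "e \<le> 0" using sub[OF t0', of x0] unfolding distrib_left by linarith
    with e show ?thesis by simp
  qed
  with mx[OF t1, of x1] have "u t1 x1 \<le> m + e * (F x1 + (K + 1) * t1)"
    by (simp add: p_def algebra_simps)
  also have "e * (F x1 + (K + 1) * t1) \<le> d"
    using pos \<open>d > 0\<close> by (simp add: e_def field_simps)
  finally show "u t1 x1 \<le> m + d" by simp
qed

text \<open>The part of the definition of a classical solution that the maximum principle sees. Unlike
the full definition, it is evidently stable under linear combinations and time shifts, which
is how linearity and the semigroup law are obtained from uniqueness.\<close>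

definition bounded_solution :: "(real \<Rightarrow> real^'n \<Rightarrow> real) \<Rightarrow> bool" where
  "bounded_solution u \<longleftrightarrow> continuous_on ({0..} \<times> UNIV) (\<lambda>(t, x). u t x) \<and>
     (\<exists>M. \<forall>t\<ge>0. \<forall>x. \<bar>u t x\<bar> \<le> M) \<and>
     (\<forall>t>0. C2 (u t) \<and> (\<forall>x. ((\<lambda>s. u s x) has_real_derivative gen_op Q B (u t) x) (at t)))"

lemma bounded_solution_classical:
  assumes "classical_solution Q B \<phi> u" shows "bounded_solution u"
proof -
  from assms have b: "bounded ((\<lambda>(t, x). u t x) ` ({0..} \<times> UNIV))"
    by (simp add: classical_solution_def)
  then obtain M where "\<And>p. p \<in> (\<lambda>(t, x). u t x) ` ({0..} \<times> UNIV) \<Longrightarrow> norm p \<le> M"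
    unfolding bounded_iff by blast
  then have "\<forall>t\<ge>0. \<forall>x. \<bar>u t x\<bar> \<le> M" by force
  moreover have "((\<lambda>s. u s x) has_real_derivative gen_op Q B (u t) x) (at t)" if "t > 0" for t x
    using assms that unfolding classical_solution_def by (metis DERIV_deriv_iff_field_differentiable)
  ultimately show ?thesis using assms unfolding bounded_solution_def classical_solution_def by blast
qed

lemma bounded_solution_lincomb:
  assumes "bounded_solution u" "bounded_solution w" shows "bounded_solution (\<lambda>t x. u t x + c * w t x)"
proof -
  from assms obtain M N where MN: "\<And>t x. t \<ge> 0 \<Longrightarrow> \<bar>u t x\<bar> \<le> M" "\<And>t x. t \<ge> 0 \<Longrightarrow> \<bar>w t x\<bar> \<le> N"
    unfolding bounded_solution_def by blast
  have "\<bar>u t x + c * w t x\<bar> \<le> M + \<bar>c\<bar> * N" if "t \<ge> 0" for t x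
    by (rule order_trans[OF abs_triangle_ineq]) (auto simp: abs_mult intro!: add_mono mult_left_mono MN that)
  then have "\<exists>M. \<forall>t\<ge>0. \<forall>x. \<bar>u t x + c * w t x\<bar> \<le> M" by blast
  moreover have "continuous_on ({0..} \<times> UNIV) (\<lambda>(t, x). u t x + c * w t x)"
    using assms unfolding bounded_solution_def case_prod_unfold by (intro continuous_intros) auto
  moreover have "C2 (\<lambda>x. u t x + c * w t x) \<and>
     (\<forall>x. ((\<lambda>s. u s x + c * w s x) has_real_derivative gen_op Q B (\<lambda>x. u t x + c * w t x) x) (at t))"
    if "t > 0" for t
  proof -
    have C: "C2 (u t)" "C2 (w t)" using assms that by (auto simp: bounded_solution_def)
    show ?thesis
      using assms that unfolding bounded_solution_def C2_lincomb(2)[OF C]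
      by (auto intro!: C2_lincomb C derivative_eq_intros)
  qed
  ultimately show ?thesis unfolding bounded_solution_def by blast
qed

lemma bounded_solution_shift:
  assumes "bounded_solution u" "h \<ge> 0" shows "bounded_solution (\<lambda>t. u (t + h))"
proof -
  have c: "continuous_on ({0..} \<times> UNIV) (\<lambda>(t, x). u t x)" using assms by (simp add: bounded_solution_def)
  have "continuous_on ({0..} \<times> UNIV) (\<lambda>p. (\<lambda>(t, x). u t x) (fst p + h, snd p))"
    by (rule continuous_on_compose2[OF c]) (use assms(2) in \<open>auto intro!: continuous_intros\<close>)
  moreover have "((\<lambda>s. u (s + h) x) has_real_derivative gen_op Q B (u (t + h)) x) (at t)"
    if "t > 0" for t x
  proof -
    have "((\<lambda>s. u s x) has_real_derivative gen_op Q B (u (t + h)) x) (at (t + h))"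
      using assms that unfolding bounded_solution_def by simp
    then show ?thesis by (simp add: DERIV_shift)
  qed
  ultimately show ?thesis using assms unfolding bounded_solution_def
    by (auto simp: case_prod_unfold) (metis add_nonneg_nonneg)
qed

text \<open>The supersolution \<open>W\<close> may be unbounded above; this is what allows \<open>F\<close> itself to enter the
barriers below.\<close>

lemma bounded_solution_comparison:
  assumes u: "bounded_solution u"
    and W: "continuous_on ({0..\<tau>} \<times> UNIV) (\<lambda>(t, x). W t x)"
    and Wb: "\<And>t x. t \<in> {0..\<tau>} \<Longrightarrow> N \<le> W t x"
    and C2: "\<And>t. t \<in> {0<..\<tau>} \<Longrightarrow> C2 (W t)"
    and dW: "\<And>t x. t \<in> {0<..\<tau>} \<Longrightarrow> ((\<lambda>s. W s x) has_real_derivative W' t x) (at t)"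
    and super: "\<And>t x. t \<in> {0<..\<tau>} \<Longrightarrow> gen_op Q B (W t) x \<le> W' t x"
    and init: "\<And>x. u 0 x \<le> W 0 x" and t: "t \<in> {0..\<tau>}"
  shows "u t x \<le> W t x"
proof -
  obtain M where M: "\<And>t x. t \<ge> 0 \<Longrightarrow> \<bar>u t x\<bar> \<le> M" using u unfolding bounded_solution_def by blast
  have "u t x + (-1) * W t x \<le> 0"
  proof (rule max_principle[where u = "\<lambda>t x. u t x + (-1) * W t x" and M = "M - N"
        and u' = "\<lambda>t x. gen_op Q B (u t) x - W' t x" and \<tau> = \<tau>])
    have "continuous_on ({0..\<tau>} \<times> UNIV) (\<lambda>(t, x). u t x)"
      using u unfolding bounded_solution_def by (auto intro: continuous_on_subset)
    then show "continuous_on ({0..\<tau>} \<times> UNIV) (\<lambda>(t, x). u t x + (-1) * W t x)"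
      using W unfolding case_prod_unfold by (intro continuous_intros) auto
    show "u t x + (-1) * W t x \<le> M - N" if "t \<in> {0..\<tau>}" for t x
      using M[of t x] Wb[OF that, of x] that by simp
    fix t x assume t: "t \<in> {0<..\<tau>}"
    have C: "C2 (u t)" using u t by (auto simp: bounded_solution_def)
    show "C2 (\<lambda>x. u t x + (-1) * W t x)" by (intro C2_lincomb C C2 t)
    show "((\<lambda>s. u s x + (-1) * W s x) has_real_derivative gen_op Q B (u t) x - W' t x) (at t)"
      using u t by (auto simp: bounded_solution_def intro!: derivative_eq_intros dW[OF t])
    show "gen_op Q B (u t) x - W' t x \<le> gen_op Q B (\<lambda>x. u t x + (-1) * W t x) x"
      unfolding C2_lincomb(2)[OF C C2[OF t]] using super[OF t, of x] by simp
  qed (use init t in \<open>simp_all add: algebra_simps\<close>)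
  then show ?thesis by simp
qed

lemma bounded_solution_unique:
  assumes "bounded_solution u" "bounded_solution w" "\<And>x. u 0 x = w 0 x" "t \<ge> 0"
  shows "u t x = w t x"
proof -
  have *: "u t x \<le> w t x" if uw: "bounded_solution u" "bounded_solution w" "\<And>x. u 0 x = w 0 x" for u w
  proof -
    obtain M where M: "\<And>t x. t \<ge> 0 \<Longrightarrow> \<bar>w t x\<bar> \<le> M" using uw unfolding bounded_solution_def by blast
    show ?thesis
    proof (rule bounded_solution_comparison[OF uw(1), where \<tau> = t and W' = "\<lambda>t. gen_op Q B (w t)" and N = "-M"])
      show "continuous_on ({0..t} \<times> UNIV) (\<lambda>(t, x). w t x)"
        using uw unfolding bounded_solution_def by (auto intro: continuous_on_subset)
      show "- M \<le> w t x" if "t \<in> {0..t'}" for t t' x using M[of t x] that by (simp add: abs_le_iff)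
    qed (use uw assms in \<open>auto simp: bounded_solution_def\<close>)
  qed
  show ?thesis using *[OF assms(1,2)] *[OF assms(2,1)] assms(3) by (simp add: order_antisym)
qed

end

section \<open>The semigroup: linearity, contractivity, tightness\<close>

locale lyapunov_semigroup = lyapunov Q G B F K
  for Q G :: "real^'n \<Rightarrow> real^'n^'n" and B F K +
  fixes S :: "real \<Rightarrow> (real^'n \<Rightarrow> real) \<Rightarrow> real^'n \<Rightarrow> real"
  assumes semigroup: "semigroup_of Q B S"
begin

lemma S_sol:
  assumes "\<phi> \<in> bcontfun" shows "bounded_solution (\<lambda>t. S t \<phi>)" "S 0 \<phi> = \<phi>"
proof -
  have c: "classical_solution Q B \<phi> (\<lambda>t. S t \<phi>)"
    using semigroup assms unfolding semigroup_of_def by blast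
  show "bounded_solution (\<lambda>t. S t \<phi>)" by (rule bounded_solution_classical[OF c])
  show "S 0 \<phi> = \<phi>" using c by (auto simp: classical_solution_def)
qed

lemma S_lincomb:
  assumes "f \<in> bcontfun" "g \<in> bcontfun" "t \<ge> 0"
  shows "S t (\<lambda>x. f x + c * g x) x = S t f x + c * S t g x"
  by (rule bounded_solution_unique[OF S_sol(1) bounded_solution_lincomb[OF S_sol(1) S_sol(1)]])
     (use assms in \<open>auto simp: S_sol bcontfun_lincomb\<close>)

lemma S_bcontfun:
  assumes "f \<in> bcontfun" "t \<ge> 0" shows "S t f \<in> bcontfun"
proof -
  have c: "continuous_on ({0..} \<times> UNIV) (\<lambda>(t, x). S t f x)"
    and b: "\<exists>M. \<forall>t\<ge>0. \<forall>x. \<bar>S t f x\<bar> \<le> M"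
    using S_sol(1)[OF assms(1)] by (auto simp: bounded_solution_def)
  have "continuous_on UNIV (\<lambda>x. (\<lambda>(t, x). S t f x) (t, x))"
    by (rule continuous_on_compose2[OF c]) (use assms in \<open>auto intro!: continuous_intros\<close>)
  then show ?thesis using b assms(2) unfolding bcontfun_def by (auto simp: bounded_iff)
qed

lemma S_semigroup:
  assumes "f \<in> bcontfun" "t \<ge> 0" "h \<ge> 0"
  shows "S t (S h f) x = S (t + h) f x"
  by (rule bounded_solution_unique[OF S_sol(1) bounded_solution_shift[OF S_sol(1)]])
     (use assms in \<open>auto simp: S_sol S_bcontfun\<close>)

text \<open>\<open>m + e (F + K t)\<close> is a supersolution because \<open>A F \<le> K\<close>.\<close>

lemma S_le_weight:
  assumes f: "f \<in> bcontfun" and le: "\<And>x. f x \<le> m + e * F x" and e: "e \<ge> 0" and t: "t \<ge> 0"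
  shows "S t f x \<le> m + e * (F x + K * t)"
proof (rule bounded_solution_comparison[OF S_sol(1)[OF f], where \<tau> = t and W = "\<lambda>t x. m + e * (F x + K * t)"
      and W' = "\<lambda>t x. e * K" and N = m])
  have "continuous_on ({0..t} \<times> UNIV) (\<lambda>p. F (snd p))"
    by (rule continuous_on_compose2[OF C2D(4)[OF C2_F]]) (auto intro: continuous_intros)
  then show "continuous_on ({0..t} \<times> UNIV) (\<lambda>(t, x). m + e * (F x + K * t))"
    by (auto simp: case_prod_unfold intro!: continuous_intros)
  fix s x
  have *: "(\<lambda>x. m + e * (F x + K * s)) = (\<lambda>x. (m + e * (K * s)) + e * F x)"
    by (auto simp: algebra_simps)
  show "C2 (\<lambda>x. m + e * (F x + K * s))"
    unfolding * by (intro C2_lincomb C2_const C2_F)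
  show "((\<lambda>s. m + e * (F x + K * s)) has_real_derivative e * K) (at s)"
    by (auto intro!: derivative_eq_intros)
  show "gen_op Q B (\<lambda>x. m + e * (F x + K * s)) x \<le> e * K"
    unfolding * C2_lincomb(2)[OF C2_const(1) C2_F] C2_const using F_super e by (simp add: mult_left_mono)
qed (use le e t K_nonneg F_nonneg in \<open>auto simp: S_sol f\<close>)

lemma S_abs_le_weight:
  assumes f: "f \<in> bcontfun" and le: "\<And>x. \<bar>f x\<bar> \<le> m + e * F x" and e: "e \<ge> 0" and t: "t \<ge> 0"
  shows "\<bar>S t f x\<bar> \<le> m + e * (F x + K * t)"
proof -
  note z = zero_bcontfun
  have z0: "S t (\<lambda>x. 0) x = 0"
    using S_lincomb[OF z z t, of "-1" x] by simp
  have n: "S t (\<lambda>x. 0 + (-1) * f x) x = - S t f x"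
    using S_lincomb[OF z f t, of "-1" x] z0 by simp
  have "S t f x \<le> m + e * (F x + K * t)"
    by (rule S_le_weight[OF f _ e t]) (use le in \<open>simp add: abs_le_iff\<close>)
  moreover have "S t (\<lambda>x. 0 + (-1) * f x) x \<le> m + e * (F x + K * t)"
    by (rule S_le_weight[OF bcontfun_lincomb[OF z f] _ e t]) (use le in \<open>auto simp: abs_le_iff\<close>)
  ultimately show ?thesis unfolding n by linarith
qed

lemma S_contraction:
  assumes f: "f \<in> bcontfun" and le: "\<And>x. \<bar>f x\<bar> \<le> m" and t: "t \<ge> 0"
  shows "\<bar>S t f x\<bar> \<le> m"
  using S_abs_le_weight[OF f, of m 0 t x] le t by simp

text \<open>\<open>S t f x\<close> is controlled, uniformly for bounded \<open>t\<close> and \<open>x\<close>, by the values of \<open>f\<close> on a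
large ball: outside such a ball even the global bound \<open>M\<close> lies below \<open>e F\<close>. This
serves as dominated convergence for \<open>S t\<close>.\<close>

lemma S_tight:
  assumes "\<epsilon> > 0"
  obtains \<delta> R' where "\<delta> > 0"
    "\<And>f t x. f \<in> bcontfun \<Longrightarrow> (\<And>x. \<bar>f x\<bar> \<le> M) \<Longrightarrow> (\<And>x. norm x \<le> R' \<Longrightarrow> \<bar>f x\<bar> \<le> \<delta>) \<Longrightarrow>
       t \<in> {0..\<tau>} \<Longrightarrow> norm x \<le> R \<Longrightarrow> \<bar>S t f x\<bar> \<le> \<epsilon>"
proof -
  have "compact (F ` cball 0 R)"
    by (intro compact_continuous_image continuous_on_subset[OF C2D(4)[OF C2_F]]) auto
  then obtain A where A: "\<And>x. norm x \<le> R \<Longrightarrow> F x \<le> A"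
    using compact_imp_bounded[THEN bounded_imp_bdd_above] unfolding bdd_above_def by fastforce
  define D where "D = max A 0 + K * max \<tau> 0 + 1"
  have D: "D > 0" unfolding D_def using K_nonneg by (simp add: add_nonneg_pos)
  define e where "e = \<epsilon> / (2 * D)"
  have e: "e > 0" using assms D by (simp add: e_def)
  have "eventually (\<lambda>x. F x \<ge> M / e) at_infinity"
    using F_coercive by (simp add: filterlim_at_top)
  then obtain r where r: "\<And>x. norm x \<ge> r \<Longrightarrow> F x \<ge> M / e"
    unfolding eventually_at_infinity by blast
  show thesis
  proof
    show "\<epsilon>/2 > 0" using assms by simp
    fix f :: "real^'n \<Rightarrow> real" and t :: real and x :: "real^'n"
    assume f: "f \<in> bcontfun" and M: "\<And>x. \<bar>f x\<bar> \<le> M"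
      and small: "\<And>x. norm x \<le> r \<Longrightarrow> \<bar>f x\<bar> \<le> \<epsilon>/2" and t: "t \<in> {0..\<tau>}" and x: "norm x \<le> R"
    have "\<bar>f y\<bar> \<le> \<epsilon>/2 + e * F y" for y :: "real^'n"
    proof (cases "norm y \<le> r")
      case True
      then show ?thesis using small[OF True] e F_nonneg[of y] by (simp add: add_increasing2)
    next
      case False
      then have "M \<le> e * F y" using r[of y] e by (simp add: field_simps)
      then show ?thesis using M[of y] assms by simp
    qed
    then have "\<bar>S t f x\<bar> \<le> \<epsilon>/2 + e * (F x + K * t)"
      by (rule S_abs_le_weight[OF f]) (use e t in auto)
    also have "F x + K * t \<le> D"
      unfolding D_def using A[OF x] t mult_left_mono[of t "max \<tau> 0" K] K_nonneg by fastforce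
    then have "\<epsilon>/2 + e * (F x + K * t) \<le> \<epsilon>/2 + e * D" using e by simp
    also have "\<dots> = \<epsilon>" using D by (simp add: e_def)
    finally show "\<bar>S t f x\<bar> \<le> \<epsilon>" by simp
  qed
qed

end

section \<open>A cutoff function and integrals with an endpoint singularity\<close>

lemma DERIV_max_0_power:
  fixes y :: real
  shows "((\<lambda>y. max 0 y ^ (n + 2)) has_real_derivative real (n + 2) * max 0 y ^ (n + 1)) (at y)"
proof (rule linorder_cases[of y 0])
  assume "y < 0"
  have "((\<lambda>y. 0) has_real_derivative real (n + 2) * max 0 y ^ (n + 1)) (at y)"
    using \<open>y < 0\<close> by simp
  then show ?thesis
    by (rule has_field_derivative_transform_within_open[of _ _ _ "{..<0}"]) (use \<open>y < 0\<close> in auto)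
next
  assume "y > 0"
  have "((\<lambda>y. y ^ (n + 2)) has_real_derivative real (n + 2) * max 0 y ^ (n + 1)) (at y)"
    using DERIV_pow[of "n + 2" y] \<open>y > 0\<close> by (simp del: power_Suc)
  then show ?thesis
    by (rule has_field_derivative_transform_within_open[of _ _ _ "{0<..}"]) (use \<open>y > 0\<close> in auto)
next
  assume y: "y = 0"
  have "((\<lambda>h. max 0 h ^ (n + 2) / h) \<longlongrightarrow> 0) (at (0::real))"
  proof (rule Lim_null_comparison)
    have "norm (max 0 h ^ (n + 2) / h) \<le> \<bar>h\<bar> ^ (n + 1)" for h :: real
    proof (cases "h > 0")
      case False
      then have "max 0 h = 0" by simp
      then show ?thesis by (simp del: power_Suc add: zero_le_power)
    qed simp
    then show "\<forall>\<^sub>F h in at (0::real). norm (max 0 h ^ (n + 2) / h) \<le> \<bar>h\<bar> ^ (n + 1)" by simp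
    show "((\<lambda>h. \<bar>h\<bar> ^ (n + 1)) \<longlongrightarrow> 0) (at (0::real))"
      by (rule tendsto_eq_intros refl | simp)+
  qed
  then show ?thesis using y by (simp add: has_field_derivative_iff)
qed

lemma C2_sq_dist: "C2 (\<lambda>x. (x - x0) \<bullet> (x - x0 :: real^'n))"
proof -
  let ?q = "\<lambda>x. (x - x0) \<bullet> (x - x0 :: real^'n)"
  have d: "(?q has_derivative (\<lambda>h. (2 *\<^sub>R (x - x0)) \<bullet> h)) (at x)" for x
    by (auto intro!: derivative_eq_intros simp: inner_commute algebra_simps)
  have c: "continuous_on UNIV (\<lambda>x. (2 *\<^sub>R (x - x0)) $ i)" for i
    by (intro continuous_intros)
  have p: "partial_deriv i ?q = (\<lambda>x. 2 * (x $ i - x0 $ i))" for i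
    using C1I(2)[OF d c] by simp
  have d2: "((\<lambda>x. 2 * (x $ i - x0 $ i)) has_derivative (\<lambda>h. axis i 2 \<bullet> h)) (at x)" for i and x :: "real^'n"
    by (auto intro!: derivative_eq_intros bounded_linear.has_derivative[OF bounded_linear_vec_nth]
        simp: inner_axis' algebra_simps)
  show ?thesis
    unfolding C2_def p using C1I(1)[OF d c] C1I(1)[OF d2] by (auto simp: continuous_on_const)
qed

text \<open>\<open>\<zeta> x = 1 - max 0 (1 - \<bar>x - x0\<bar>\<^sup>2 / \<rho>\<^sup>2)\<^sup>3\<close>; the third power is the smallest integer power for
which the gluing is twice continuously differentiable.\<close>

lemma C2_cutoff:
  fixes x0 :: "real^'n"
  assumes \<rho>: "\<rho> > 0"
  obtains \<zeta> where "C2 \<zeta>" "\<zeta> x0 = 0" "\<And>x. \<zeta> x \<ge> 0"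
    "\<And>x. norm (x - x0) \<ge> \<rho> \<Longrightarrow> \<zeta> x = 1" "\<And>x. norm (x - x0) \<ge> \<rho> \<Longrightarrow> gen_op Q B \<zeta> x = 0"
proof -
  define q where "q x = (x - x0) \<bullet> (x - x0)" for x
  define h h1 h2 :: "real \<Rightarrow> real" where "h s = 1 - max 0 (1 - s / \<rho>^2) ^ 3"
    and "h1 s = 3 / \<rho>^2 * max 0 (1 - s / \<rho>^2) ^ 2"
    and "h2 s = - 6 / (\<rho>^2 * \<rho>^2) * max 0 (1 - s / \<rho>^2)" for s
  have inner: "((\<lambda>s. 1 - s / \<rho>^2) has_real_derivative - 1 / \<rho>^2) (at s)" for s
    using DERIV_diff[OF DERIV_const DERIV_cdivide[OF DERIV_ident]] by simp
  have p: "((\<lambda>s. max 0 (1 - s / \<rho>^2) ^ (n + 2)) has_real_derivative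
      real (n + 2) * max 0 (1 - s / \<rho>^2) ^ (n + 1) * (- 1 / \<rho>^2)) (at s)" for n s
    by (rule DERIV_chain2[OF DERIV_max_0_power inner])
  have h: "(h has_real_derivative h1 s) (at s)" for s
    using DERIV_diff[OF DERIV_const p[of 1 s], of 1]
    by (simp add: h_def[abs_def] h1_def numeral_3_eq_3 numeral_2_eq_2)
  have h1: "(h1 has_real_derivative h2 s) (at s)" for s
    using DERIV_cmult[OF p[of 0 s], of "3 / \<rho>^2"] \<rho>
    by (simp add: h1_def[abs_def] h2_def numeral_2_eq_2)
  have h2: "continuous_on A h2" for A unfolding h2_def[abs_def] by (intro continuous_intros) (use \<rho> in auto)
  have C2q: "C2 q" unfolding q_def[abs_def] by (rule C2_sq_dist)
  have out: "max 0 (1 - q x / \<rho>^2) = 0" if "norm (x - x0) \<ge> \<rho>" for x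
    using that \<rho> power_mono[OF that, of 2] by (simp add: q_def power2_norm_eq_inner[symmetric] field_simps)
  show thesis
  proof
    show "C2 (\<lambda>x. h (q x))" by (rule C2_compose(1)[OF C2q h h1 h2])
    show "h (q x0) = 0" by (simp add: h_def q_def)
    show "h (q x) \<ge> 0" for x
    proof -
      have "max 0 (1 - q x / \<rho>^2) ^ 3 \<le> 1" by (rule power_le_one) (auto simp: q_def)
      then show ?thesis by (simp add: h_def)
    qed
    show "h (q x) = 1" if "norm (x - x0) \<ge> \<rho>" for x using out[OF that] by (simp add: h_def)
    show "gen_op Q B (\<lambda>x. h (q x)) x = 0" if "norm (x - x0) \<ge> \<rho>" for x
      unfolding C2_compose(2)[OF C2q h h1 h2] using out[OF that] by (simp add: h1_def h2_def)
  qed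
qed

text \<open>The integrands of the mild equation carry no information at the terminal time and may blow up
as it is approached; half-open intervals take care of both, and the Lebesgue integral
is replaced by the gauge integral, for which the fundamental theorem of calculus is at hand.\<close>

lemma integrable_halfopen:
  fixes f k :: "real \<Rightarrow> real"
  assumes f: "continuous_on {t..<T} f" and le: "\<And>r. r \<in> {t..<T} \<Longrightarrow> \<bar>f r\<bar> \<le> k r"
    and k: "k integrable_on {t..T}"
  shows "f integrable_on {t..T}" "(LINT r:{t..T}|lborel. f r) = integral {t..T} f"
proof -
  have neg: "negligible (sym_diff {t..<T} {t..T})"
    by (rule negligible_subset[of "{T}"]) auto
  have k': "k integrable_on {t..<T}" using k integrable_spike_set_eq[OF neg] by blast
  have fm: "f \<in> borel_measurable (lebesgue_on {t..<T})"
    by (rule continuous_imp_measurable_on_sets_lebesgue[OF f]) auto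
  have "f absolutely_integrable_on {t..<T}"
    by (rule measurable_bounded_by_integrable_imp_absolutely_integrable[OF fm _ k']) (use le in auto)
  moreover have "(\<lambda>r. indicator {t..<T} r *\<^sub>R f r) \<in> borel_measurable borel"
    by (rule borel_measurable_continuous_on_indicator[OF _ f]) auto
  ultimately have i: "set_integrable lborel {t..<T} f"
    unfolding set_integrable_def by (subst (asm) integrable_completion) auto
  show "f integrable_on {t..T}"
    using set_borel_integral_eq_integral(1)[OF i] integrable_spike_set_eq[OF neg] by blast
  have "(LINT r:{t..T}|lborel. f r) = (LINT r:{t..<T}|lborel. f r)"
    unfolding set_lebesgue_integral_def
    by (rule integral_discrete_difference[of "{T}"]) (auto simp: indicator_def)
  also have "\<dots> = integral {t..<T} f" by (rule set_borel_integral_eq_integral(2)[OF i])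
  also have "\<dots> = integral {t..T} f" by (rule integral_spike_set) (auto intro: negligible_subset[of "{T}"])
  finally show "(LINT r:{t..T}|lborel. f r) = integral {t..T} f" .
qed

lemma integral_diff_const_le:
  fixes f :: "real \<Rightarrow> real"
  assumes "a \<le> b" "f integrable_on {a..b}" "\<And>r. r \<in> {a..b} \<Longrightarrow> \<bar>f r - c\<bar> \<le> D"
  shows "\<bar>integral {a..b} f - (b - a) * c\<bar> \<le> (b - a) * D"
proof -
  have "integral {a..b} (\<lambda>r. f r - c) = integral {a..b} f - (b - a) * c"
    using assms by (subst integral_diff) auto
  moreover have "norm (integral {a..b} (\<lambda>r. f r - c)) \<le> integral {a..b} (\<lambda>r. D)"
    by (rule integral_norm_bound_integral) (use assms in \<open>auto intro: integrable_diff\<close>)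
  ultimately show ?thesis using assms(1) by simp
qed

lemma integral_linearization:
  fixes f :: "real \<Rightarrow> real"
  assumes f: "f integrable_on {s..T}" and y: "a \<in> {s..T}" "b \<in> {s..T}"
    and D: "\<And>r. r \<in> closed_segment a b \<Longrightarrow> \<bar>f r - f a\<bar> \<le> D"
  shows "\<bar>integral {s..b} f - integral {s..a} f - (b - a) * f a\<bar> \<le> \<bar>b - a\<bar> * D"
proof (cases "a \<le> b")
  case True
  have "integral {s..a} f + integral {a..b} f = integral {s..b} f"
    by (rule Henstock_Kurzweil_Integration.integral_combine)
       (use True y in \<open>auto intro: integrable_subinterval_real[OF f]\<close>)
  moreover have "\<bar>integral {a..b} f - (b - a) * f a\<bar> \<le> (b - a) * D"
    by (rule integral_diff_const_le)
       (use True y D in \<open>auto intro: integrable_subinterval_real[OF f] simp: closed_segment_eq_real_ivl\<close>)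
  ultimately show ?thesis using True by simp
next
  case False
  then have "b \<le> a" by simp
  have "integral {s..b} f + integral {b..a} f = integral {s..a} f"
    by (rule Henstock_Kurzweil_Integration.integral_combine)
       (use False y in \<open>auto intro: integrable_subinterval_real[OF f]\<close>)
  moreover have "\<bar>integral {b..a} f - (a - b) * f a\<bar> \<le> (a - b) * D"
    by (rule integral_diff_const_le)
       (use False y D in \<open>auto intro: integrable_subinterval_real[OF f] simp: closed_segment_eq_real_ivl\<close>)
  ultimately show ?thesis using False by (simp add: algebra_simps abs_if split: if_splits)
qed

section \<open>Short-time behaviour and integrals of the semigroup\<close>

context lyapunov_semigroup begin

text \<open>The global bound \<open>A F \<le> K\<close> gives the estimate with \<open>K\<close> in place of \<open>A F x0 + \<kappa>\<close>
(see \<open>S_le_weight\<close>). To localise it, the barrier \<open>F + t (A F x0 + \<kappa>)\<close>, which is a supersolution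
only near \<open>x0\<close>, is raised away from \<open>x0\<close> by \<open>K1 t \<zeta>\<close> with the cutoff \<open>\<zeta>\<close>: outside the ball its
time derivative compensates \<open>A F\<close>, inside the ball the error \<open>K1 t A \<zeta>\<close> is at most \<open>\<kappa> / 2\<close>
for short times, and at \<open>x0\<close> nothing is added.\<close>

lemma S_local_generator:
  assumes cQ: "\<And>i j. continuous_on UNIV (\<lambda>x. Q x $ i $ j)"
    and cB: "\<And>i. continuous_on UNIV (\<lambda>x. B x $ i)" and \<kappa>: "\<kappa> > 0"
  obtains \<tau> where "\<tau> > 0"
    "\<And>f m e t. f \<in> bcontfun \<Longrightarrow> e \<ge> 0 \<Longrightarrow> (\<And>x. f x \<le> m + e * F x) \<Longrightarrow> t \<in> {0..\<tau>} \<Longrightarrow>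
       S t f x0 \<le> m + e * (F x0 + t * (gen_op Q B F x0 + \<kappa>))"
proof -
  define A0 where "A0 = gen_op Q B F x0"
  define K1 where "K1 = K - A0"
  have K1: "K1 \<ge> 0" using F_super by (simp add: K1_def A0_def)
  have "isCont (gen_op Q B F) x0"
    using gen_op_continuous[OF C2_F cQ cB] by (simp add: continuous_on_eq_continuous_at)
  then obtain \<rho> where \<rho>: "\<rho> > 0" and near: "\<And>x. norm (x - x0) < \<rho> \<Longrightarrow> gen_op Q B F x < A0 + \<kappa>/2"
    unfolding continuous_at_eps_delta A0_def dist_norm
    by (metis abs_less_iff add_diff_cancel_left' diff_less_eq half_gt_zero \<kappa> real_norm_def add.commute)
  obtain \<zeta> where \<zeta>: "C2 \<zeta>" "\<zeta> x0 = 0" "\<And>x. \<zeta> x \<ge> 0"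
    "\<And>x. norm (x - x0) \<ge> \<rho> \<Longrightarrow> \<zeta> x = 1" "\<And>x. norm (x - x0) \<ge> \<rho> \<Longrightarrow> gen_op Q B \<zeta> x = 0"
    using C2_cutoff[OF \<rho>, of x0 Q B] by metis
  have "compact (gen_op Q B \<zeta> ` cball x0 \<rho>)"
    by (intro compact_continuous_image continuous_on_subset[OF gen_op_continuous[OF \<zeta>(1) cQ cB]]) auto
  then obtain C' where C': "\<And>x. x \<in> cball x0 \<rho> \<Longrightarrow> gen_op Q B \<zeta> x \<le> C'"
    using compact_imp_bounded[THEN bounded_imp_bdd_above] unfolding bdd_above_def by fastforce
  define C where "C = max C' 0"
  have C: "gen_op Q B \<zeta> x \<le> C" "C \<ge> 0" for x
    using C'[of x] \<zeta>(5)[of x] by (auto simp: C_def dist_norm norm_minus_commute max_def)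
      (smt (verit))+
  define \<tau> where "\<tau> = \<kappa> / (2 * (K1 * C + 1))"
  have den: "K1 * C + 1 > 0" using K1 C(2) by (simp add: add_nonneg_pos)
  have \<tau>: "\<tau> > 0" "K1 * \<tau> * C \<le> \<kappa>/2" using \<kappa> den by (auto simp: \<tau>_def field_simps)
  show thesis
  proof
    show "\<tau> > 0" by fact
    fix f :: "real^'n \<Rightarrow> real" and m e t :: real
    assume f: "f \<in> bcontfun" and e: "e \<ge> 0" and le: "\<And>x. f x \<le> m + e * F x" and t: "t \<in> {0..\<tau>}"
    define W where "W s x = (m + e * ((A0 + \<kappa>) * s) + e * F x) + (e * K1 * s) * \<zeta> x" for s x
    have Cl: "C2 (\<lambda>x. (m + e * ((A0 + \<kappa>) * s)) + e * F x)" for s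
      by (intro C2_lincomb C2_const C2_F)
    have "S t f x0 \<le> W t x0"
    proof (rule bounded_solution_comparison[OF S_sol(1)[OF f], where \<tau> = \<tau>
          and W' = "\<lambda>t x. e * (A0 + \<kappa>) + e * K1 * \<zeta> x" and N = "m - \<bar>e * (A0 + \<kappa>)\<bar> * \<tau>"])
      have "continuous_on ({0..\<tau>} \<times> UNIV) (\<lambda>p. F (snd p))"
        by (rule continuous_on_compose2[OF C2D(4)[OF C2_F]]) (auto intro: continuous_intros)
      moreover have "continuous_on ({0..\<tau>} \<times> UNIV) (\<lambda>p. \<zeta> (snd p))"
        by (rule continuous_on_compose2[OF C2D(4)[OF \<zeta>(1)]]) (auto intro: continuous_intros)
      ultimately show "continuous_on ({0..\<tau>} \<times> UNIV) (\<lambda>(t, x). W t x)"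
        by (auto simp: case_prod_unfold W_def intro!: continuous_intros)
      show "m - \<bar>e * (A0 + \<kappa>)\<bar> * \<tau> \<le> W s x" if s: "s \<in> {0..\<tau>}" for s x
      proof -
        have "\<bar>e * (A0 + \<kappa>) * s\<bar> \<le> \<bar>e * (A0 + \<kappa>)\<bar> * \<tau>"
          unfolding abs_mult using s by (intro mult_left_mono) auto
        moreover have "e * F x \<ge> 0" "e * K1 * s * \<zeta> x \<ge> 0" using e F_nonneg K1 s \<zeta>(3) by auto
        ultimately show ?thesis unfolding W_def by (simp add: mult.assoc)
      qed
      show "C2 (W s)" for s unfolding W_def[abs_def] by (intro C2_lincomb(1) Cl \<zeta>(1))
      show "((\<lambda>s. W s x) has_real_derivative e * (A0 + \<kappa>) + e * K1 * \<zeta> x) (at s)" for s x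
        unfolding W_def by (auto intro!: derivative_eq_intros)
      show "gen_op Q B (W s) x \<le> e * (A0 + \<kappa>) + e * K1 * \<zeta> x" if s: "s \<in> {0<..\<tau>}" for s x
      proof -
        have W: "gen_op Q B (W s) x = e * (gen_op Q B F x + K1 * s * gen_op Q B \<zeta> x)"
          unfolding W_def[abs_def] C2_lincomb(2)[OF Cl \<zeta>(1)] C2_lincomb(2)[OF C2_const(1) C2_F] C2_const(2)
          by (simp add: algebra_simps)
        have "gen_op Q B F x + K1 * s * gen_op Q B \<zeta> x \<le> (A0 + \<kappa>) + K1 * \<zeta> x"
        proof (cases "norm (x - x0) < \<rho>")
          case True
          have "K1 * s * gen_op Q B \<zeta> x \<le> K1 * s * C" using C K1 s by (intro mult_left_mono) auto
          also have "\<dots> \<le> K1 * \<tau> * C" using K1 C s by (intro mult_right_mono mult_left_mono) auto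
          also have "\<dots> \<le> \<kappa>/2" by (rule \<tau>(2))
          finally show ?thesis using near[OF True] mult_nonneg_nonneg[OF K1 \<zeta>(3)[of x]] by linarith
        next
          case False
          then show ?thesis using \<zeta>(4,5)[of x] F_super[of x] \<kappa> by (simp add: K1_def)
        qed
        then show ?thesis unfolding W using mult_left_mono[OF _ e] by (simp add: distrib_left mult.assoc) (metis distrib_left)
      qed
    qed (use le t in \<open>auto simp: S_sol f W_def\<close>)
    then show "S t f x0 \<le> m + e * (F x0 + t * (gen_op Q B F x0 + \<kappa>))"
      by (simp add: W_def \<zeta>(2) A0_def algebra_simps)
  qed
qed

text \<open>\<open>S (r - s') (g r)\<close> is compared with \<open>S (r - s') (g r0)\<close>, which is continuous because it is a
classical solution; the difference is small by tightness, as \<open>g r\<close> tends to \<open>g r0\<close>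
uniformly on compact sets.\<close>

lemma S_joint_continuous:
  assumes g: "continuous_on ({s..<T} \<times> UNIV) (\<lambda>(r, x). g r x)"
    and bc: "\<And>r. r \<in> {s..<T} \<Longrightarrow> g r \<in> bcontfun"
    and le: "\<And>r x. r \<in> {s..<T} \<Longrightarrow> \<bar>g r x\<bar> \<le> k r"
    and k: "continuous_on {s..<T} k" and s': "s' \<le> s"
  shows "continuous_on ({s..<T} \<times> UNIV) (\<lambda>(r, x). S (r - s') (g r) x)"
  unfolding continuous_on_def
proof
  fix p :: "real \<times> (real^'n)" assume "p \<in> {s..<T} \<times> UNIV"
  then obtain r0 x0 where p: "p = (r0, x0)" and r0: "r0 \<in> {s..<T}" by auto
  let ?D = "{s..<T} \<times> (UNIV :: (real^'n) set)"
  define d where "d r x = g r x + (-1) * g r0 x" for r x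
  have dbc: "d r \<in> bcontfun" if "r \<in> {s..<T}" for r
    unfolding d_def[abs_def] by (intro bcontfun_lincomb bc that r0)
  have split: "S (r - s') (g r) x = S (r - s') (d r) x + S (r - s') (g r0) x" if "r \<in> {s..<T}" for r x
    using S_lincomb[OF bc[OF that] bc[OF r0], of "r - s'" "-1" x] that s' by (simp add: d_def[abs_def])
  have "((\<lambda>p. S (fst p - s') (d (fst p)) (snd p)) \<longlongrightarrow> 0) (at (r0, x0) within ?D)"
  proof (rule tendstoI)
    fix \<epsilon> :: real assume "\<epsilon> > 0"
    then have "\<epsilon>/2 > 0" by simp
    then obtain \<delta> R' where \<delta>: "\<delta> > 0" and tight:
      "\<And>f t x. f \<in> bcontfun \<Longrightarrow> (\<And>x. \<bar>f x\<bar> \<le> (k r0 + 1) + k r0) \<Longrightarrow>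
        (\<And>x. norm x \<le> R' \<Longrightarrow> \<bar>f x\<bar> \<le> \<delta>) \<Longrightarrow>
       t \<in> {0..r0 + 1 - s'} \<Longrightarrow> norm x \<le> norm x0 + 1 \<Longrightarrow> \<bar>S t f x\<bar> \<le> \<epsilon>/2"
      using S_tight[of "\<epsilon>/2" "(k r0 + 1) + k r0" "r0 + 1 - s'" "norm x0 + 1"] by metis
    obtain X0 where X0: "r0 \<in> X0" "open X0"
      "\<forall>r\<in>X0 \<inter> {s..<T}. \<forall>x\<in>cball 0 R'. dist (g r x) (g r0 x) \<le> \<delta>"
      using continuous_on_prod_compactE[OF continuous_on_subset[OF g] compact_cball r0 \<delta>, of 0 R']
      by auto
    obtain X1 where X1: "r0 \<in> X1" "open X1" "\<And>r. r \<in> {s..<T} \<Longrightarrow> r \<in> X1 \<Longrightarrow> k r < k r0 + 1"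
      using k[unfolded continuous_on_topological, rule_format, OF r0, of "{..<k r0 + 1}"] by auto
    define V where "V = (X0 \<inter> X1 \<inter> {..<r0 + 1}) \<times> ball x0 1"
    have "open V" "(r0, x0) \<in> V" unfolding V_def using X0 X1 by (auto intro!: open_Times)
    moreover have "dist (S (r - s') (d r) x) 0 < \<epsilon>" if rx: "(r, x) \<in> V" "r \<in> {s..<T}" for r x
    proof -
      have nx: "norm x \<le> norm x0 + 1"
        using rx norm_triangle_sub[of x x0] by (auto simp: V_def dist_norm norm_minus_commute)
      have "\<bar>S (r - s') (d r) x\<bar> \<le> \<epsilon>/2"
      proof (rule tight[OF dbc[OF rx(2)] _ _ _ nx])
        show "\<bar>d r y\<bar> \<le> (k r0 + 1) + k r0" for y
          using le[OF rx(2), of y] le[OF r0, of y] X1(3)[OF rx(2)] rx(1) by (auto simp: d_def V_def)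
        show "\<bar>d r y\<bar> \<le> \<delta>" if "norm y \<le> R'" for y
          using X0(3) rx that by (auto simp: V_def d_def dist_real_def)
        show "r - s' \<in> {0..r0 + 1 - s'}" using rx s' by (auto simp: V_def)
      qed
      then show ?thesis using \<open>\<epsilon> > 0\<close> by simp
    qed
    ultimately show "\<forall>\<^sub>F p in at (r0, x0) within ?D. dist (S (fst p - s') (d (fst p)) (snd p)) 0 < \<epsilon>"
      unfolding eventually_at_topological by (intro exI[of _ V]) auto
  qed
  moreover have "((\<lambda>p. S (fst p - s') (g r0) (snd p)) \<longlongrightarrow> S (r0 - s') (g r0) x0) (at (r0, x0) within ?D)"
  proof -
    have c: "continuous_on ({0..} \<times> UNIV) (\<lambda>(t, x). S t (g r0) x)"
      using S_sol(1)[OF bc[OF r0]] by (simp add: bounded_solution_def)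
    have "continuous_on ?D (\<lambda>p. (\<lambda>(t, x). S t (g r0) x) (fst p - s', snd p))"
      by (rule continuous_on_compose2[OF c]) (use s' in \<open>auto intro!: continuous_intros\<close>)
    then show ?thesis using r0 unfolding continuous_on_def by fastforce
  qed
  ultimately have *: "((\<lambda>p. S (fst p - s') (d (fst p)) (snd p) + S (fst p - s') (g r0) (snd p))
      \<longlongrightarrow> S (r0 - s') (g r0) x0) (at (r0, x0) within ?D)"
    using tendsto_add by fastforce
  show "((\<lambda>(r, x). S (r - s') (g r) x) \<longlongrightarrow> (case p of (r, x) \<Rightarrow> S (r - s') (g r) x)) (at p within ?D)"
    unfolding p prod.case
    by (rule Lim_transform_eventually[OF *]) (auto simp: eventually_at_topological split intro!: exI[of _ UNIV])
qed

end

lemma continuous_on_slices: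
  assumes "continuous_on (A \<times> UNIV) (\<lambda>(r, x). f r x)"
  shows "continuous_on A (\<lambda>r. f r x)" "r \<in> A \<Longrightarrow> continuous_on UNIV (f r)"
proof -
  have "continuous_on A (\<lambda>r. (\<lambda>(r, x). f r x) (r, x))"
    by (rule continuous_on_compose2[OF assms]) (auto intro!: continuous_intros)
  then show "continuous_on A (\<lambda>r. f r x)" by simp
  assume "r \<in> A"
  then have "continuous_on UNIV (\<lambda>x. (\<lambda>(r, x). f r x) (r, x))"
    by (intro continuous_on_compose2[OF assms]) (auto intro!: continuous_intros)
  then show "continuous_on UNIV (f r)" by simp
qed

context lyapunov_semigroup begin

lemma S_zero:
  assumes "t \<ge> 0" shows "S t (\<lambda>x. 0) x = 0"
  using S_contraction[OF zero_bcontfun, of 0 t x] assms by simp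

text \<open>\<open>S h\<close> commutes with the time integral because \<open>E y = S h (\<integral>\<^sub>s\<^sup>y \<phi> r dr) x0\<close> has the derivative
\<open>S h (\<phi> y) x0\<close>: the difference quotients of the inner integral converge to \<open>\<phi> y\<close> boundedly
and uniformly on compact sets, so tightness applies. Contractivity makes \<open>E\<close> continuous up to
the singular endpoint, and the fundamental theorem of calculus concludes.\<close>

lemma S_integral:
  fixes s T :: real
  assumes c: "continuous_on ({s..<T} \<times> UNIV) (\<lambda>(r, x). \<phi> r x)"
    and bc: "\<And>r. r \<in> {s..T} \<Longrightarrow> \<phi> r \<in> bcontfun"
    and le: "\<And>r x. r \<in> {s..T} \<Longrightarrow> \<bar>\<phi> r x\<bar> \<le> k r"
    and ck: "continuous_on {s..<T} k" and ik: "k integrable_on {s..T}"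
    and bT: "(\<lambda>x. integral {s..T} (\<lambda>r. \<phi> r x)) \<in> bcontfun"
    and "s \<le> T" and h: "h \<ge> 0"
  shows "((\<lambda>r. S h (\<phi> r) x0) has_integral S h (\<lambda>x. integral {s..T} (\<lambda>r. \<phi> r x)) x0) {s..T}"
proof -
  define P where "P y x = integral {s..y} (\<lambda>r. \<phi> r x)" for y x
  have cx: "continuous_on {s..<T} (\<lambda>r. \<phi> r x)" for x
    by (rule continuous_on_slices(1)[OF c])
  have i: "(\<lambda>r. \<phi> r x) integrable_on {s..T}" for x
    by (rule integrable_halfopen(1)[OF cx _ ik]) (use le in auto)
  have k0: "k r \<ge> 0" if "r \<in> {s..T}" for r using le[OF that, of 0] by simp
  have P_diff: "\<bar>P b x - P a x\<bar> \<le> integral {s..b} k - integral {s..a} k"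
    if ab: "s \<le> a" "a \<le> b" "b \<le> T" for a b x
  proof -
    note sub = integrable_subinterval_real
    have "P a x + integral {a..b} (\<lambda>r. \<phi> r x) = P b x" unfolding P_def
      by (rule Henstock_Kurzweil_Integration.integral_combine) (use ab in \<open>auto intro: sub[OF i]\<close>)
    moreover have "integral {s..a} k + integral {a..b} k = integral {s..b} k"
      by (rule Henstock_Kurzweil_Integration.integral_combine) (use ab in \<open>auto intro: sub[OF ik]\<close>)
    moreover have "norm (integral {a..b} (\<lambda>r. \<phi> r x)) \<le> integral {a..b} k"
      by (rule integral_norm_bound_integral) (use ab le in \<open>auto intro: sub[OF i] sub[OF ik]\<close>)
    ultimately show ?thesis by simp
  qed
  have P_bc: "P y \<in> bcontfun" if y: "y \<in> {s..T}" for y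
  proof (cases "y = T")
    case True
    then show ?thesis using bT by (simp add: P_def[abs_def])
  next
    case False
    have "continuous_on (UNIV \<times> cbox s y) (\<lambda>p. (\<lambda>(r, x). \<phi> r x) (snd p, fst p))"
      by (rule continuous_on_compose2[OF c]) (use y False in \<open>auto intro!: continuous_intros\<close>)
    then have "continuous_on (UNIV \<times> cbox s y) (\<lambda>(x, r). \<phi> r x)" by (simp add: case_prod_unfold)
    from integral_continuous_on_param[OF this] have "continuous_on UNIV (P y)"
      by (simp add: P_def[abs_def])
    moreover have "\<bar>P y x\<bar> \<le> integral {s..y} k" for x
      using P_diff[of s y x] y by (simp add: P_def)
    ultimately show ?thesis by (auto simp: bcontfun_def bounded_iff)
  qed
  define E where "E y = S h (P y) x0" for y
  have E_diff: "\<bar>E b - E a\<bar> \<le> \<bar>integral {s..b} k - integral {s..a} k\<bar>"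
    if "a \<in> {s..T}" "b \<in> {s..T}" for a b
  proof -
    have *: "\<bar>S h (\<lambda>x. P b x + (-1) * P a x) x0\<bar> \<le> \<bar>integral {s..b} k - integral {s..a} k\<bar>"
    proof (rule S_contraction[OF bcontfun_lincomb[OF P_bc P_bc] _ h])
      fix x show "\<bar>P b x + (-1) * P a x\<bar> \<le> \<bar>integral {s..b} k - integral {s..a} k\<bar>"
        using P_diff[of a b x] P_diff[of b a x] that by (cases "a \<le> b") auto
    qed (use that in auto)
    then show ?thesis
      using S_lincomb[OF P_bc[OF that(2)] P_bc[OF that(1)] h, of "-1" x0] by (simp add: E_def)
  qed
  have cont_E: "continuous_on {s..T} E"
    unfolding continuous_on_def
  proof
    fix a assume a: "a \<in> {s..T}"
    have "((\<lambda>y. integral {s..y} k - integral {s..a} k) \<longlongrightarrow> 0) (at a within {s..T})"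
      using indefinite_integral_continuous_1[OF ik] a unfolding continuous_on_def
      by (simp add: LIM_zero_iff)
    then have "((\<lambda>y. \<bar>integral {s..y} k - integral {s..a} k\<bar>) \<longlongrightarrow> 0) (at a within {s..T})"
      by (rule tendsto_rabs_zero)
    moreover have "\<forall>\<^sub>F y in at a within {s..T}. norm (E y - E a) \<le> \<bar>integral {s..y} k - integral {s..a} k\<bar>"
      using E_diff[OF a] by (auto simp: eventually_at_filter)
    ultimately have "((\<lambda>y. E y - E a) \<longlongrightarrow> 0) (at a within {s..T})"
      by (rule Lim_null_comparison[rotated])
    then show "(E \<longlongrightarrow> E a) (at a within {s..T})" by (simp add: LIM_zero_iff)
  qed
  have deriv_E: "(E has_vector_derivative S h (\<phi> a) x0) (at a)" if a: "a \<in> {s<..<T}" for a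
  proof -
    have a': "a \<in> {s..<T}" "a \<in> {s..T}" using a by auto
    have "((\<lambda>y. (E y - E a) / (y - a)) \<longlongrightarrow> S h (\<phi> a) x0) (at a)"
    proof (rule tendstoI)
      fix \<epsilon> :: real assume "\<epsilon> > 0"
      then have "\<epsilon>/2 > 0" by simp
      then obtain \<delta> R' where \<delta>: "\<delta> > 0" and tight:
        "\<And>f t x. f \<in> bcontfun \<Longrightarrow> (\<And>x. \<bar>f x\<bar> \<le> (k a + 1) + k a) \<Longrightarrow>
          (\<And>x. norm x \<le> R' \<Longrightarrow> \<bar>f x\<bar> \<le> \<delta>) \<Longrightarrow>
         t \<in> {0..h} \<Longrightarrow> norm x \<le> norm x0 \<Longrightarrow> \<bar>S t f x\<bar> \<le> \<epsilon>/2"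
        using S_tight[of "\<epsilon>/2" "(k a + 1) + k a" h "norm x0"] by metis
      obtain X0 where X0: "a \<in> X0" "open X0"
        "\<forall>r\<in>X0 \<inter> {s..<T}. \<forall>x\<in>cball 0 R'. dist (\<phi> r x) (\<phi> a x) \<le> \<delta>"
        using continuous_on_prod_compactE[OF continuous_on_subset[OF c] compact_cball a'(1) \<delta>, of 0 R']
        by auto
      obtain X1 where X1: "a \<in> X1" "open X1" "\<And>r. r \<in> {s..<T} \<Longrightarrow> r \<in> X1 \<Longrightarrow> k r < k a + 1"
        using ck[unfolded continuous_on_topological, rule_format, OF a'(1), of "{..<k a + 1}"] by auto
      have "open (X0 \<inter> X1 \<inter> {s<..<T})" using X0 X1 by auto
      then obtain d where d: "d > 0" "ball a d \<subseteq> X0 \<inter> X1 \<inter> {s<..<T}"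
        using X0(1) X1(1) a by (meson IntI open_contains_ball)
      have "dist ((E y - E a) / (y - a)) (S h (\<phi> a) x0) < \<epsilon>" if y: "y \<noteq> a" "dist y a < d" for y
      proof -
        have seg: "closed_segment a y \<subseteq> ball a d"
          using y d by (intro closed_segment_subset) (auto simp: dist_commute)
        have rin: "r \<in> X0 \<and> r \<in> X1 \<and> r \<in> {s..<T}" if "r \<in> closed_segment a y" for r
          using seg d(2) that by fastforce
        have yT: "y \<in> {s..T}" using rin[of y] by auto
        \<comment> \<open>the error of the difference quotient of the inner integral\<close>
        define f where "f x = (1 / (y - a)) * (P y x + (-1) * P a x) + (-1) * \<phi> a x" for x
        have fb: "(\<lambda>x. P y x + (-1) * P a x) \<in> bcontfun"
          by (intro bcontfun_lincomb P_bc yT a')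
        have fb': "(\<lambda>x. 0 + (1 / (y - a)) * (P y x + (-1) * P a x)) \<in> bcontfun"
          by (intro bcontfun_lincomb fb zero_bcontfun)
        have f_bc: "f \<in> bcontfun"
          using bcontfun_lincomb[OF fb' bc[OF a'(2)], of "-1"] by (simp add: f_def[abs_def])
        have Sf: "S h f x0 = (E y - E a) / (y - a) - S h (\<phi> a) x0"
          using S_lincomb[OF fb' bc[OF a'(2)] h, of "-1" x0]
            S_lincomb[OF zero_bcontfun fb h, of "1 / (y - a)" x0] S_zero[OF h, of x0]
            S_lincomb[OF P_bc[OF yT] P_bc[OF a'(2)] h, of "-1" x0]
          by (simp add: f_def[abs_def] E_def)
        have f_le: "\<bar>f x\<bar> \<le> D" if D: "\<And>r. r \<in> closed_segment a y \<Longrightarrow> \<bar>\<phi> r x - \<phi> a x\<bar> \<le> D" for x D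
        proof -
          have "\<bar>P y x - P a x - (y - a) * \<phi> a x\<bar> \<le> \<bar>y - a\<bar> * D"
            unfolding P_def by (rule integral_linearization[OF i a'(2) yT D])
          moreover have "P y x - P a x - (y - a) * \<phi> a x = (y - a) * f x"
            using y(1) by (simp add: f_def field_simps)
          ultimately show ?thesis using y(1) by (simp add: abs_mult)
        qed
        have "\<bar>S h f x0\<bar> \<le> \<epsilon>/2"
        proof (rule tight[OF f_bc])
          show "\<bar>f x\<bar> \<le> (k a + 1) + k a" for x
          proof (rule f_le)
            fix r assume "r \<in> closed_segment a y"
            then have r: "r \<in> X1" "r \<in> {s..<T}" using rin by auto
            show "\<bar>\<phi> r x - \<phi> a x\<bar> \<le> (k a + 1) + k a"
              using le[of r x] le[OF a'(2), of x] X1(3)[OF r(2,1)] r by auto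
          qed
          show "\<bar>f x\<bar> \<le> \<delta>" if "norm x \<le> R'" for x
            by (rule f_le) (use X0(3) rin that in \<open>auto simp: dist_real_def\<close>)
        qed (use h in auto)
        then show ?thesis using Sf \<open>\<epsilon> > 0\<close> by (simp add: dist_real_def)
      qed
      then show "\<forall>\<^sub>F y in at a. dist ((E y - E a) / (y - a)) (S h (\<phi> a) x0) < \<epsilon>"
        using d(1) by (auto simp: eventually_at)
    qed
    then show ?thesis
      by (simp add: has_real_derivative_iff_has_vector_derivative[symmetric] has_field_derivative_iff)
  qed
  have "((\<lambda>r. S h (\<phi> r) x0) has_integral (E T - E s)) {s..T}"
    by (rule fundamental_theorem_of_calculus_interior[OF \<open>s \<le> T\<close> cont_E deriv_E])
  moreover have "E s = 0" using S_zero[OF h] by (simp add: E_def P_def[abs_def])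
  ultimately show ?thesis by (simp add: E_def P_def[abs_def])
qed

lemma mild_integral_split:
  assumes c: "continuous_on ({s0..<T} \<times> UNIV) (\<lambda>(r, x). g r x)"
    and bc: "\<And>r. r \<in> {s0..T} \<Longrightarrow> g r \<in> bcontfun"
    and le: "\<And>r x. r \<in> {s0..T} \<Longrightarrow> \<bar>g r x\<bar> \<le> k r"
    and ck: "continuous_on {s0..<T} k" and ik: "k integrable_on {s0..T}"
    and z: "\<And>t x. t \<in> {s0..T} \<Longrightarrow> z t x = integral {t..T} (\<lambda>r. S (r - t) (g r) x)"
    and t: "s0 \<le> t" "0 \<le> h" "t + h \<le> T" and bz: "z (t + h) \<in> bcontfun"
  shows "(\<lambda>r. S (r - t) (g r) x) integrable_on {t..T}"
    "z t x = integral {t..t + h} (\<lambda>r. S (r - t) (g r) x) + S h (z (t + h)) x"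
proof -
  have cS: "continuous_on ({u..<T} \<times> UNIV) (\<lambda>(r, x). S (r - u) (g r) x)" if u: "s0 \<le> u" for u
    by (rule S_joint_continuous[where k = k])
       (use u bc le in \<open>auto intro: continuous_on_subset[OF c] continuous_on_subset[OF ck]\<close>)
  have bS: "\<bar>S (r - u) (g r) x\<bar> \<le> k r" if "s0 \<le> u" "r \<in> {u..T}" for u r x
    by (rule S_contraction) (use that bc le in auto)
  have ik': "k integrable_on {u..T}" if "s0 \<le> u" for u
    by (rule integrable_subinterval_real[OF ik]) (use that in auto)
  have cSx: "continuous_on {u..<T} (\<lambda>r. S (r - u) (g r) x)" if u: "s0 \<le> u" for u
    by (rule continuous_on_slices(1)[OF cS[OF u]])
  show int: "(\<lambda>r. S (r - t) (g r) x) integrable_on {t..T}"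
    by (rule integrable_halfopen(1)[OF cSx _ ik']) (use t bS in auto)
  have "((\<lambda>r. S h (S (r - (t + h)) (g r)) x) has_integral S h (z (t + h)) x) {t + h..T}"
  proof -
    have zh: "z (t + h) = (\<lambda>x. integral {t + h..T} (\<lambda>r. S (r - (t + h)) (g r) x))"
      using z t by auto
    show ?thesis
      unfolding zh
      by (rule S_integral[where k = k, OF cS])
         (use t bz[unfolded zh] bS bc ik' in \<open>auto intro!: S_bcontfun continuous_on_subset[OF ck]\<close>)
  qed
  then have "((\<lambda>r. S (r - t) (g r) x) has_integral S h (z (t + h)) x) {t + h..T}"
    by (rule has_integral_eq[rotated]) (use t bc in \<open>auto simp: S_semigroup\<close>)
  moreover have "integral {t..t + h} (\<lambda>r. S (r - t) (g r) x) + integral {t + h..T} (\<lambda>r. S (r - t) (g r) x) = z t x"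
    by (subst z) (use t int in \<open>auto intro!: Henstock_Kurzweil_Integration.integral_combine\<close>)
  ultimately show "z t x = integral {t..t + h} (\<lambda>r. S (r - t) (g r) x) + S h (z (t + h)) x"
    by (simp add: integral_unique)
qed

end

section \<open>The comparison argument\<close>

text \<open>The viscosity argument described at the beginning. The source enters with the sign for which
\<open>z\<close> formally solves \<open>D\<^sub>t z + A z = - g\<close>, so that an upper bound of \<open>g\<close> by the gradient of \<open>z\<close>
forces \<open>z \<le> 0\<close>.\<close>

lemma (in lyapunov_semigroup) mild_comparison:
  assumes cQ: "\<And>i j. continuous_on UNIV (\<lambda>x. Q x $ i $ j)"
    and cB: "\<And>i. continuous_on UNIV (\<lambda>x. B x $ i)"
    and F_strict: "\<And>x. gen_op Q B F x \<le> K - (norm (G x *v grad F x))^2 / 2"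
    and c: "continuous_on ({s0..<T} \<times> UNIV) (\<lambda>(r, x). g r x)"
    and bc: "\<And>r. r \<in> {s0..T} \<Longrightarrow> g r \<in> bcontfun"
    and le: "\<And>r x. r \<in> {s0..T} \<Longrightarrow> \<bar>g r x\<bar> \<le> k r"
    and ck: "continuous_on {s0..<T} k" and ik: "k integrable_on {s0..T}"
    and z: "\<And>t x. t \<in> {s0..T} \<Longrightarrow> z t x = integral {t..T} (\<lambda>r. S (r - t) (g r) x)"
    and cz: "continuous_on ({s0..T} \<times> UNIV) (\<lambda>(t, x). z t x)"
    and bz: "\<And>t x. t \<in> {s0..T} \<Longrightarrow> \<bar>z t x\<bar> \<le> M"
    and dz: "\<And>t x. t \<in> {s0..<T} \<Longrightarrow> z t differentiable (at x)"
    and gz: "\<And>t x. t \<in> {s0..<T} \<Longrightarrow> g t x \<le> L * norm (G x *v grad (z t) x)"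
    and t1: "t1 \<in> {s0..T}"
  shows "z t1 x1 \<le> 0"
proof (rule field_le_epsilon)
  fix d :: real assume d: "d > 0"
  define K' where "K' = K + L^2 / 2 + 1"
  have K': "K' > 0" unfolding K'_def using K_nonneg by (simp add: add_nonneg_pos)
  \<comment> \<open>\<open>e\<close> below makes the penalty at \<open>(t1, x1)\<close> at most \<open>d\<close>\<close>
  define D where "D = F x1 + K' * (T - t1) + 1"
  have D: "D > 0" unfolding D_def using F_nonneg[of x1] K' t1 by (simp add: add_nonneg_pos)
  define e where "e = d / D"
  have e: "e > 0" using d D by (simp add: e_def)
  define p where "p t x = z t x - e * K' * (T - t)" for t x
  have p: "continuous_on ({s0..T} \<times> UNIV) (\<lambda>(t, x). p t x)"
    using cz by (auto simp: p_def case_prod_unfold intro!: continuous_intros)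
  have pM: "p t x \<le> M" if "t \<in> {s0..T}" for t x
  proof -
    have "e * K' * (T - t) \<ge> 0" using e K' that by simp
    then show ?thesis using bz[OF that, of x] by (simp add: p_def)
  qed
  have "s0 \<le> T" using t1 by simp
  obtain t0 x0 where t0: "t0 \<in> {s0..T}"
    and mx: "\<And>t x. t \<in> {s0..T} \<Longrightarrow> p t x - e * F x \<le> p t0 x0 - e * F x0"
    using attains_max_coercive[OF p \<open>s0 \<le> T\<close> pM C2D(4)[OF C2_F] F_coercive e] by blast
  define c0 where "c0 = p t0 x0 - e * F x0"
  have "c0 \<le> 0"
  proof (cases "t0 = T")
    case True
    moreover have "e * F x0 \<ge> 0" using e F_nonneg by simp
    ultimately show ?thesis using z[OF t0, of x0] by (simp add: c0_def p_def)
  next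
    case False
    then have t0': "t0 \<in> {s0..<T}" using t0 by auto
    have grad_eq: "grad (z t0) x0 = e *\<^sub>R grad F x0"
    proof -
      have "((\<lambda>x. z t0 x - e * F x) has_derivative (\<lambda>h. (grad (z t0) x0 - e *\<^sub>R grad F x0) \<bullet> h)) (at x0)"
        by (rule derivative_eq_intros has_derivative_grad dz[OF t0'] C2D(3)[OF C2_F] refl)+
           (simp add: inner_diff_left)
      moreover from this have "grad (\<lambda>x. z t0 x - e * F x) x0 = 0"
        by (intro grad_zero_at_max) (use mx[OF t0] in \<open>auto simp: p_def differentiable_def\<close>)
      ultimately show ?thesis using grad_eqI by fastforce
    qed
    obtain \<tau> where \<tau>: "\<tau> > 0"
      and gen: "\<And>f m e t. f \<in> bcontfun \<Longrightarrow> e \<ge> 0 \<Longrightarrow> (\<And>x. f x \<le> m + e * F x) \<Longrightarrow> t \<in> {0..\<tau>} \<Longrightarrow>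
        S t f x0 \<le> m + e * (F x0 + t * (gen_op Q B F x0 + 1/4))"
      using S_local_generator[OF cQ cB, of "1/4" x0] by auto
    have "continuous_on ({t0..<T} \<times> UNIV) (\<lambda>(r, x). S (r - t0) (g r) x)"
      by (rule S_joint_continuous[where k = k])
         (use t0 bc le in \<open>auto intro: continuous_on_subset[OF c] continuous_on_subset[OF ck]\<close>)
    then have "continuous_on {t0..<T} (\<lambda>r. S (r - t0) (g r) x0)" by (rule continuous_on_slices(1))
    then obtain \<delta> where \<delta>: "\<delta> > 0"
 "\<forall>r\<in>{t0..<T}. dist r t0 < \<delta> \<longrightarrow> dist (S (r - t0) (g r) x0) (S (t0 - t0) (g t0) x0) < e/4"
      unfolding continuous_on_iff using t0' e by (metis atLeastLessThan_iff order_refl zero_less_divide_iff zero_less_numeral)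
    then have near: "S (r - t0) (g r) x0 \<le> g t0 x0 + e/4" if "r \<in> {t0..<T}" "r - t0 < \<delta>" for r
    proof -
      have "dist (S (r - t0) (g r) x0) (S (t0 - t0) (g t0) x0) < e/4"
        using \<delta>(2) that by (simp add: dist_real_def)
      then show ?thesis unfolding diff_self S_sol(2)[OF bc[OF t0]] dist_real_def by linarith
    qed
    define h where "h = min \<tau> (min (\<delta>/2) ((T - t0)/2))"
    have h: "h > 0" "h \<le> \<tau>" "h < \<delta>" "t0 + h < T"
      using \<tau> \<delta> t0' by (auto simp: h_def min_def field_simps)
    have th: "t0 + h \<in> {s0..T}" using h t0 by auto
    have zb: "z (t0 + h) \<in> bcontfun"
      unfolding bcontfun_def using continuous_on_slices(2)[OF cz th] bz[OF th] by (auto simp: bounded_iff)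
    note split = mild_integral_split[OF c bc le ck ik z, of t0 h x0]
    have "integral {t0..t0 + h} (\<lambda>r. S (r - t0) (g r) x0) \<le> integral {t0..t0 + h} (\<lambda>r. g t0 x0 + e/4)"
      by (rule integral_le)
         (use h t0 zb near in \<open>auto intro: integrable_subinterval_real[OF split(1)]\<close>)
    also have "\<dots> = h * (g t0 x0 + e/4)" using h by simp
    finally have I: "integral {t0..t0 + h} (\<lambda>r. S (r - t0) (g r) x0) \<le> h * (g t0 x0 + e/4)" .
    have "z t0 x0 = integral {t0..t0 + h} (\<lambda>r. S (r - t0) (g r) x0) + S h (z (t0 + h)) x0"
      by (rule split(2)) (use h t0 zb in auto)
    also have "S h (z (t0 + h)) x0
        \<le> (c0 + e * K' * (T - (t0 + h))) + e * (F x0 + h * (gen_op Q B F x0 + 1/4))"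
    proof (rule gen[OF zb])
      show "z (t0 + h) x \<le> (c0 + e * K' * (T - (t0 + h))) + e * F x" for x
        using mx[OF th, of x] by (simp add: p_def c0_def)
    qed (use e h in auto)
    finally have "h * (e * K') \<le> h * (g t0 x0 + e * (gen_op Q B F x0 + 1/2))"
      using I by (simp add: c0_def p_def algebra_simps)
    \<comment> \<open>what remains of the equation at \<open>(t0, x0)\<close> with \<open>z\<close> replaced by the penalty\<close>
    then have 1: "e * K' \<le> g t0 x0 + e * (gen_op Q B F x0 + 1/2)" using h(1) by simp
    define q where "q = norm (G x0 *v grad F x0)"
    have "g t0 x0 \<le> e * (L * q)"
      using gz[OF t0', of x0] e by (simp add: grad_eq matrix_vector_mult_scaleR q_def mult.left_commute)
    with 1 have "e * K' \<le> e * (L * q + gen_op Q B F x0 + 1/2)" by (simp add: distrib_left)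
    then have "K' \<le> L * q + gen_op Q B F x0 + 1/2" using e by simp
    also have "\<dots> \<le> L * q + (K - q^2/2) + 1/2" using F_strict[of x0] by (simp add: q_def)
    also have "\<dots> \<le> K + L^2/2 + 1/2"
      using zero_le_power2[of "L - q"] by (simp add: power2_diff)
    finally show ?thesis by (simp add: K'_def)
  qed
  with mx[OF t1, of x1] have "z t1 x1 \<le> e * (F x1 + K' * (T - t1))"
    by (simp add: p_def c0_def algebra_simps)
  also have "\<dots> \<le> e * D" using e by (simp add: D_def)
  also have "\<dots> = d" using D by (simp add: e_def)
  finally show "z t1 x1 \<le> 0 + d" by simp
qed

section \<open>The coefficients and the source term\<close>

text \<open>With \<open>p = f + const \<ge> 1\<close> one has \<open>A p \<le> const * p\<close>, and the claim for \<open>F = ln p\<close> follows from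
\<open>A (ln p) = A p / p - \<bar>G \<nabla>(ln p)\<bar>\<^sup>2 / 2\<close>.\<close>

lemma log_lyapunov:
  assumes sq: "\<And>x. pos_def_sqrt (Q x) (G x)" and H5: "H5 Q B"
  obtains F K where "C2 F" "\<And>x. F x \<ge> 0" "filterlim F at_top at_infinity" "K \<ge> 0"
    "\<And>x. gen_op Q B F x \<le> K - (norm (G x *v grad F x))^2 / 2"
proof -
  from H5 obtain c f C where c: "c > 0" and f: "C2 f" "filterlim f at_top at_infinity"
    and C: "\<And>x. gen_op Q B f x - c * f x \<le> C"
    unfolding H5_def bdd_above_def by auto
  have "eventually (\<lambda>x. f x \<ge> 0) at_infinity" using f(2) by (simp add: filterlim_at_top)
  then obtain r where r: "\<And>x. norm x \<ge> r \<Longrightarrow> f x \<ge> 0" unfolding eventually_at_infinity by blast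
  have "compact (f ` cball 0 r)"
    by (intro compact_continuous_image continuous_on_subset[OF C2D(4)[OF f(1)]]) auto
  then obtain m where m: "\<And>x. norm x \<le> r \<Longrightarrow> m \<le> f x"
    using compact_imp_bounded[THEN bounded_imp_bdd_below] unfolding bdd_below_def by fastforce
  define c0 where "c0 = \<bar>m\<bar> + 1"
  define p where "p x = f x + c0 * 1" for x
  have p1: "p x \<ge> 1" for x
    using r[of x] m[of x] by (cases "norm x \<le> r") (auto simp: p_def c0_def)
  have p: "C2 p" "gen_op Q B p x = gen_op Q B f x" for x
    unfolding p_def[abs_def] C2_lincomb(2)[OF f(1) C2_const(1)] C2_const(2)
    by (rule C2_lincomb(1)[OF f(1) C2_const(1)]) simp
  have d1: "(ln has_real_derivative inverse (p x)) (at (p x))" for x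
    using p1[of x] by (auto intro!: derivative_eq_intros simp: inverse_eq_divide)
  have d2: "(inverse has_real_derivative - ((inverse (p x))^2)) (at (p x))" for x
    using DERIV_inverse[of "p x"] p1[of x] by (simp add: numeral_2_eq_2)
  have c1: "continuous_on (range p) inverse" "continuous_on (range p) (\<lambda>s. - ((inverse s)^2))"
    using p1 by (auto intro!: continuous_intros) (metis not_one_le_zero)+
  note F = C2_compose[OF p(1) d1 d2 c1(2)]
  have gF: "grad (\<lambda>x. ln (p x)) x = inverse (p x) *\<^sub>R grad p x" for x
    by (simp add: vec_eq_iff C1_compose(2)[OF C2D(1)[OF p(1)] d1 c1(1)])
  have QG: "(Q x *v \<xi>) \<bullet> \<xi> = (norm (G x *v \<xi>))^2" for x \<xi>
  proof -
    have "transpose (G x) = G x" "Q x = G x ** G x"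
      using sq[of x] by (auto simp: pos_def_sqrt_def sym_pos_def_def)
    then show ?thesis
      by (metis dot_lmul_matrix inner_commute matrix_vector_mul_assoc power2_norm_eq_inner transpose_matrix_vector)
  qed
  show thesis
  proof
    show "C2 (\<lambda>x. ln (p x))" by (rule F(1))
    show "ln (p x) \<ge> 0" for x using p1[of x] by simp
    have "filterlim p at_top at_infinity"
      by (rule filterlim_at_top_mono[OF f(2)]) (auto simp: p_def c0_def)
    then show "filterlim (\<lambda>x. ln (p x)) at_top at_infinity"
      by (rule filterlim_compose[OF ln_at_top])
    show "\<bar>C\<bar> + c \<ge> 0" using c by simp
    fix x
    have "gen_op Q B p x \<le> C + c * f x" using C[of x] p(2) by simp
    also have "\<dots> \<le> \<bar>C\<bar> * p x + c * p x"
    proof (rule add_mono)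
      have "C \<le> \<bar>C\<bar> * 1" by simp
      also have "\<dots> \<le> \<bar>C\<bar> * p x" using p1 by (intro mult_left_mono) auto
      finally show "C \<le> \<bar>C\<bar> * p x" .
      show "c * f x \<le> c * p x" using c by (simp add: p_def c0_def)
    qed
    finally have "inverse (p x) * gen_op Q B p x \<le> \<bar>C\<bar> + c"
      using p1[of x] by (simp add: field_simps)
    moreover have "\<bar>p x\<bar> = p x" using p1[of x] by simp
    ultimately show "gen_op Q B (\<lambda>x. ln (p x)) x \<le> (\<bar>C\<bar> + c) - (norm (G x *v grad (\<lambda>x. ln (p x)) x))^2 / 2"
      unfolding F(2) gF matrix_vector_mult_scaleR QG by (simp add: power_mult_distrib)
  qed
qed

lemma pos_def_coercive:
  fixes A :: "real^'n^'n"
  assumes "sym_pos_def A"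
  obtains c where "c > 0" "\<And>\<xi>. c * (norm \<xi>)^2 \<le> (A *v \<xi>) \<bullet> \<xi>"
proof -
  have ne: "sphere (0::real^'n) 1 \<noteq> {}" by simp
  have "continuous_on (sphere 0 1) (\<lambda>\<xi>. (A *v \<xi>) \<bullet> \<xi>)"
    by (intro continuous_intros linear_continuous_on matrix_vector_mul_bounded_linear)
  from continuous_attains_inf[OF compact_sphere ne this]
  obtain \<eta> where \<eta>: "\<eta> \<in> sphere 0 1"
    "\<And>\<xi>. \<xi> \<in> sphere 0 1 \<Longrightarrow> (A *v \<eta>) \<bullet> \<eta> \<le> (A *v \<xi>) \<bullet> \<xi>"
    by blast
  show thesis
  proof
    have "\<eta> \<noteq> 0" using \<eta>(1) by auto
    then show "(A *v \<eta>) \<bullet> \<eta> > 0" using assms by (simp add: sym_pos_def_def)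
    fix \<xi> :: "real^'n"
    show "(A *v \<eta>) \<bullet> \<eta> * (norm \<xi>)^2 \<le> (A *v \<xi>) \<bullet> \<xi>"
    proof (cases "\<xi> = 0")
      case False
      then have "(1 / norm \<xi>) *\<^sub>R \<xi> \<in> sphere 0 1" by simp
      from \<eta>(2)[OF this] False show ?thesis
        by (simp add: matrix_vector_mult_scaleR power2_eq_square field_simps)
    qed simp
  qed
qed

text \<open>With \<open>D = G x - G x0\<close> one has \<open>Q x - Q x0 = G x D + D G x0\<close>. Taking the Frobenius inner product
with \<open>D\<close>, the first summand is nonnegative and the second is at least \<open>c \<bar>D\<bar>\<^sup>2\<close>, where \<open>c\<close>
is the coercivity constant of \<open>G x0\<close>; hence \<open>\<bar>D\<bar> \<le> \<bar>Q x - Q x0\<bar> / c\<close>.\<close>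

lemma pos_def_sqrt_continuous:
  fixes Q G :: "'a::topological_space \<Rightarrow> real^'n^'n"
  assumes sq: "\<And>x. pos_def_sqrt (Q x) (G x)" and Q: "continuous_on UNIV Q"
  shows "continuous_on UNIV G"
  unfolding continuous_on_def
proof
  fix x0
  obtain c where c: "c > 0" "\<And>\<xi>. c * (norm \<xi>)^2 \<le> (G x0 *v \<xi>) \<bullet> \<xi>"
    using pos_def_coercive[of "G x0"] sq[of x0] by (auto simp: pos_def_sqrt_def)
  have le: "norm (G x - G x0) \<le> norm (Q x - Q x0) / c" for x
  proof -
    define D where "D = G x - G x0"
    have E: "Q x - Q x0 = G x ** D + D ** G x0"
      using sq[of x] sq[of x0] unfolding pos_def_sqrt_def D_def
      by (auto simp: vec_eq_iff matrix_matrix_mult_def sum.distrib[symmetric] algebra_simps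
          sum_subtractf)
    have s: "G x0 $ i $ j = G x0 $ j $ i" for i j
      using sq[of x0] unfolding pos_def_sqrt_def sym_pos_def_def by (metis transpose_def vec_lambda_beta)
    have "(D ** G x0) $ i = G x0 *v (D $ i)" for i
      unfolding vec_eq_iff matrix_matrix_mult_def matrix_vector_mult_def vec_lambda_beta
      by (intro allI sum.cong refl) (subst s, rule mult.commute)
    then have "D \<bullet> (D ** G x0) = (\<Sum>i\<in>UNIV. (G x0 *v (D $ i)) \<bullet> (D $ i))"
      unfolding inner_vec_def[of D] by (simp add: inner_commute)
    also have "\<dots> \<ge> (\<Sum>i\<in>UNIV. c * (norm (D $ i))^2)" by (intro sum_mono c(2))
    also have "(\<Sum>i\<in>UNIV. c * (norm (D $ i))^2) = c * (norm D)^2"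
      unfolding power2_norm_eq_inner sum_distrib_left[symmetric] by (simp add: inner_vec_def)
    finally have 1: "c * (norm D)^2 \<le> D \<bullet> (D ** G x0)" .
    have "D \<bullet> (G x ** D) = (\<Sum>j\<in>UNIV. \<Sum>i\<in>UNIV. D $ i $ j * (G x ** D) $ i $ j)"
      unfolding inner_vec_def inner_real_def by (rule sum.swap)
    also have "\<dots> = (\<Sum>j\<in>UNIV. (G x *v column j D) \<bullet> column j D)"
      unfolding inner_vec_def matrix_matrix_mult_def matrix_vector_mult_def column_def
      by (simp add: mult.commute)
    also have "\<dots> \<ge> 0"
    proof (rule sum_nonneg)
      show "(G x *v column j D) \<bullet> column j D \<ge> 0" for j
        using sq[of x] unfolding pos_def_sqrt_def sym_pos_def_def
        by (cases "column j D = 0") (auto intro: less_imp_le)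
    qed
    finally have "c * (norm D)^2 \<le> D \<bullet> (Q x - Q x0)"
      unfolding E inner_add_right using 1 by simp
    also have "\<dots> \<le> norm D * norm (Q x - Q x0)" by (rule norm_cauchy_schwarz)
    finally show ?thesis using c(1) unfolding D_def[symmetric]
      by (cases "D = 0") (simp_all add: power2_eq_square field_simps)
  qed
  have "(Q \<longlongrightarrow> Q x0) (at x0)" using Q by (simp add: continuous_on_def)
  then have "((\<lambda>x. norm (Q x - Q x0) / c) \<longlongrightarrow> 0) (at x0)"
    using tendsto_divide_zero tendsto_norm_zero LIM_zero by blast
  then have "((\<lambda>x. G x - G x0) \<longlongrightarrow> 0) (at x0)"
    by (rule Lim_null_comparison[rotated]) (simp add: le)
  then show "(G \<longlongrightarrow> G x0) (at x0 within UNIV)" by (simp add: LIM_zero_iff)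
qed

lemma integrable_inverse_sqrt:
  fixes t T :: real
  assumes "t \<le> T"
  shows "(\<lambda>r. 1 / sqrt (T - r)) integrable_on {t..T}"
proof -
  have "((\<lambda>r. 1 / sqrt (T - r)) has_integral (- 2 * sqrt (T - T) - (- 2 * sqrt (T - t)))) {t..T}"
  proof (rule fundamental_theorem_of_calculus_interior[OF assms])
    show "continuous_on {t..T} (\<lambda>r. - 2 * sqrt (T - r))" by (intro continuous_intros)
    fix r assume "r \<in> {t<..<T}"
    then have "((\<lambda>r. - 2 * sqrt (T - r)) has_real_derivative 1 / sqrt (T - r)) (at r)"
      by (auto intro!: derivative_eq_intros simp: field_simps)
    then show "((\<lambda>r. - 2 * sqrt (T - r)) has_vector_derivative 1 / sqrt (T - r)) (at r)"
      by (simp add: has_real_derivative_iff_has_vector_derivative)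
  qed
  then show ?thesis by blast
qed

lemma nonlin_K_space:
  fixes G :: "real^'n \<Rightarrow> real^'n^'n"
  assumes \<psi>: "continuous_on UNIV (\<lambda>(x, y). \<psi> x y)"
    and L: "L \<ge> 0" "\<And>x y. \<bar>\<psi> x y - \<psi> x 0\<bar> \<le> L * norm y" "\<And>x. \<bar>\<psi> x 0\<bar> \<le> L"
    and G: "continuous_on UNIV G" and u: "u \<in> K_space G T a"
  obtains c where "c \<ge> 0"
    "continuous_on ({T - a..<T} \<times> UNIV) (\<lambda>(r, x). nonlin G \<psi> r u x)"
    "\<And>r x. r \<in> {T - a..<T} \<Longrightarrow> \<bar>nonlin G \<psi> r u x\<bar> \<le> L + L * c * (1 / sqrt (T - r))"
    "\<And>r. r \<in> {T - a..<T} \<Longrightarrow> nonlin G \<psi> r u \<in> bcontfun"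
proof -
  let ?D = "{T - a..<T} \<times> (UNIV :: (real^'n) set)"
  have cg: "continuous_on ?D (\<lambda>(t, x). grad (u t) x)" using u by (simp add: K_space_def)
  obtain c' where c': "\<And>r x. r \<in> {T - a..<T} \<Longrightarrow> sqrt (T - r) * norm (G x *v grad (u r) x) \<le> c'"
    using u unfolding K_space_def bdd_above_def by fastforce
  define c where "c = max c' 0"
  have cont: "continuous_on ?D (\<lambda>(r, x). nonlin G \<psi> r u x)"
  proof -
    have cG: "continuous_on ?D (\<lambda>p. G (snd p))"
      by (rule continuous_on_compose2[OF G]) (auto intro: continuous_intros)
    have "continuous_on ?D (\<lambda>p. G (snd p) *v grad (u (fst p)) (snd p))"
      unfolding matrix_vector_mult_def
      by (intro continuous_intros cG cg[unfolded case_prod_unfold])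
    then have "continuous_on ?D (\<lambda>p. (snd p, G (snd p) *v grad (u (fst p)) (snd p)))"
      by (intro continuous_intros)
    from continuous_on_compose2[OF \<psi> this] show ?thesis
      by (simp add: nonlin_def case_prod_unfold)
  qed
  have bound: "\<bar>nonlin G \<psi> r u x\<bar> \<le> L + L * c * (1 / sqrt (T - r))" if r: "r \<in> {T - a..<T}" for r x
  proof -
    have "norm (G x *v grad (u r) x) \<le> c * (1 / sqrt (T - r))"
      using c'[OF r, of x] r by (simp add: c_def field_simps)
    then have "L * norm (G x *v grad (u r) x) \<le> L * c * (1 / sqrt (T - r))"
      using mult_left_mono[OF _ L(1)] unfolding mult.assoc by blast
    then show ?thesis using L(2)[of x "G x *v grad (u r) x"] L(3)[of x] unfolding nonlin_def by linarith
  qed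
  have "nonlin G \<psi> r u \<in> bcontfun" if r: "r \<in> {T - a..<T}" for r
    using continuous_on_slices(2)[OF cont r] bound[OF r] by (auto simp: bcontfun_def bounded_iff)
  then show thesis using that[OF _ cont bound] by (simp add: c_def)
qed

section \<open>Uniqueness of mild solutions\<close>

theorem proposition2p3:
  fixes Q G :: "real^'n \<Rightarrow> real^'n^'n"
    and B :: "real^'n \<Rightarrow> real^'n"
    and \<nu> b \<phi> :: "real^'n \<Rightarrow> real"
    and S :: "real \<Rightarrow> (real^'n \<Rightarrow> real) \<Rightarrow> real^'n \<Rightarrow> real"
    and \<psi> :: "real^'n \<Rightarrow> real^'n \<Rightarrow> real"
    and T a :: real
    and v w :: "real \<Rightarrow> real^'n \<Rightarrow> real"
  assumes "T > 0" and "a > 0" and "\<phi> \<in> bcontfun"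
    and "\<And>x. sym_pos_def (Q x)"
    and "\<And>x. pos_def_sqrt (Q x) (G x)"
    and "H1 Q B" and "H2 Q B \<nu>" and "H3 Q G B b" and "H4 Q G B \<nu> b" and "H5 Q B"
    and "semigroup_of Q B S"
    and "admissible_nonlinearity \<psi>"
    and "mild_solution S G \<psi> \<phi> T a v"
    and "mild_solution S G \<psi> \<phi> T a w"
  shows "\<forall>t\<in>{T - a..T}. \<forall>x. v t x = w t x"
proof -
  obtain F K where F: "C2 F" "\<And>x. F x \<ge> 0" "filterlim F at_top at_infinity" "K \<ge> 0"
    "\<And>x. gen_op Q B F x \<le> K - (norm (G x *v grad F x))^2 / 2"
    using log_lyapunov[OF assms(5) \<open>H5 Q B\<close>] by blast
  interpret lyapunov_semigroup Q G B F K S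
  proof
    show "gen_op Q B F x \<le> K" for x
      using F(5)[of x] zero_le_power2[of "norm (G x *v grad F x)"] by linarith
  qed (use assms F in auto)
  have cQ: "continuous_on UNIV (\<lambda>x. Q x $ i $ j)" for i j
    using \<open>H1 Q B\<close> C2D(4) unfolding H1_def by blast
  have cB: "continuous_on UNIV (\<lambda>x. B x $ i)" for i
    using \<open>H1 Q B\<close> C1D(2) unfolding H1_def by blast
  have "continuous_on UNIV (\<lambda>x. \<chi> i j. Q x $ i $ j)" by (intro continuous_intros cQ)
  then have "continuous_on UNIV Q" by simp
  then have cG: "continuous_on UNIV G" by (rule pos_def_sqrt_continuous[OF assms(5)])
  obtain L where c\<psi>: "continuous_on UNIV (\<lambda>(x, y). \<psi> x y)" and L: "L > 0"
    and lip: "\<And>x1 x2 y1 y2. \<bar>\<psi> x1 x2 - \<psi> y1 y2\<bar>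
            \<le> L * norm (x2 - y2) + L * norm (x1 - y1) * (1 + norm x2 + norm y2)"
    and \<psi>0: "\<And>x. \<bar>\<psi> x 0\<bar> \<le> L"
    using \<open>admissible_nonlinearity \<psi>\<close> unfolding admissible_nonlinearity_def by blast
  have lip': "\<bar>\<psi> x y - \<psi> x y'\<bar> \<le> L * norm (y - y')" for x y y'
    using lip[of x y x y'] by simp
  have lip0: "\<bar>\<psi> x y - \<psi> x 0\<bar> \<le> L * norm y" for x y
    using lip'[of x y 0] by simp
  have *: "w t x - v t x \<le> 0"
    if v: "mild_solution S G \<psi> \<phi> T a v" and w: "mild_solution S G \<psi> \<phi> T a w"
      and t: "t \<in> {T - a..T}" for v w t x
  proof -
    let ?D = "{T - a..<T} \<times> (UNIV :: (real^'n) set)"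
    let ?n = "nonlin G \<psi>"
    have Kv: "v \<in> K_space G T a" and Kw: "w \<in> K_space G T a"
      using v w by (auto simp: mild_solution_def)
    note source = nonlin_K_space[OF c\<psi> less_imp_le[OF L] lip0 \<psi>0 cG]
    obtain cv where cv: "cv \<ge> 0" "continuous_on ?D (\<lambda>(r, x). ?n r v x)"
      "\<And>r x. r \<in> {T - a..<T} \<Longrightarrow> \<bar>?n r v x\<bar> \<le> L + L * cv * (1 / sqrt (T - r))"
      "\<And>r. r \<in> {T - a..<T} \<Longrightarrow> ?n r v \<in> bcontfun"
      using source[OF Kv] by blast
    obtain cw where cw: "cw \<ge> 0" "continuous_on ?D (\<lambda>(r, x). ?n r w x)"
      "\<And>r x. r \<in> {T - a..<T} \<Longrightarrow> \<bar>?n r w x\<bar> \<le> L + L * cw * (1 / sqrt (T - r))"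
      "\<And>r. r \<in> {T - a..<T} \<Longrightarrow> ?n r w \<in> bcontfun"
      using source[OF Kw] by blast
    have k: "continuous_on {t..<T} (\<lambda>r. L + c * (1 / sqrt (T - r)))"
      "(\<lambda>r. L + c * (1 / sqrt (T - r))) integrable_on {t..T}" if "t \<le> T" for c t
    proof -
      show "continuous_on {t..<T} (\<lambda>r. L + c * (1 / sqrt (T - r)))"
        by (intro continuous_intros ballI) auto
      show "(\<lambda>r. L + c * (1 / sqrt (T - r))) integrable_on {t..T}"
        using integrable_add[OF _ integrable_cmul[OF integrable_inverse_sqrt[OF that], of c],
            where f = "\<lambda>_. L"]
        by (simp add: integrable_const_ivl)
    qed
    have mild: "(\<lambda>r. S (r - t) (?n r u) x) integrable_on {t..T} \<and>
        u t x = S (T - t) \<phi> x - integral {t..T} (\<lambda>r. S (r - t) (?n r u) x)"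
      if u: "mild_solution S G \<psi> \<phi> T a u" and t: "t \<in> {T - a..T}"
        and cu: "continuous_on ?D (\<lambda>(r, x). ?n r u x)"
        "\<And>r x. r \<in> {T - a..<T} \<Longrightarrow> \<bar>?n r u x\<bar> \<le> L + c * (1 / sqrt (T - r))"
        "\<And>r. r \<in> {T - a..<T} \<Longrightarrow> ?n r u \<in> bcontfun" for u t x c
    proof -
      have tT: "t \<le> T" and sub: "{t..<T} \<times> UNIV \<subseteq> ?D" using t by auto
      have "continuous_on ({t..<T} \<times> UNIV) (\<lambda>(r, x). S (r - t) (?n r u) x)"
        by (rule S_joint_continuous[OF continuous_on_subset[OF cu(1) sub] cu(3) cu(2) k(1)[OF tT]])
           (use t in auto)
      then have f: "continuous_on {t..<T} (\<lambda>r. S (r - t) (?n r u) x)"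
        by (rule continuous_on_slices(1))
      have le: "\<bar>S (r - t) (?n r u) x\<bar> \<le> L + c * (1 / sqrt (T - r))" if "r \<in> {t..<T}" for r
        by (rule S_contraction[OF cu(3) cu(2)]) (use that t in auto)
      from integrable_halfopen[OF f le k(2)[OF tT]] u t show ?thesis
        by (simp add: mild_solution_def)
    qed
    \<comment> \<open>the gradients at \<open>r = T\<close> carry no information, so the source is set to 0 there\<close>
    define g where "g r = (if r < T then (\<lambda>x. ?n r v x + (-1) * ?n r w x) else (\<lambda>x. 0))" for r
    define kk where "kk r = (L + L * cv * (1 / sqrt (T - r))) + (L + L * cw * (1 / sqrt (T - r)))" for r
    have gw: "g r x \<le> L * norm (G x *v grad (\<lambda>x. w r x - v r x) x)" if r: "r \<in> {T - a..<T}" for r x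
    proof -
      have d: "v r differentiable at x" "w r differentiable at x"
        using Kv Kw r by (auto simp: K_space_def)
      have "grad (\<lambda>x. w r x - v r x) x = grad (w r) x - grad (v r) x"
        by (rule grad_eqI, (rule derivative_eq_intros has_derivative_grad d refl)+)
           (simp add: inner_diff_left)
      moreover have "g r x \<le> L * norm (G x *v grad (v r) x - G x *v grad (w r) x)"
        using lip'[of x "G x *v grad (v r) x" "G x *v grad (w r) x"] r by (simp add: g_def nonlin_def)
      ultimately show ?thesis
        by (simp add: matrix_vector_mult_diff_distrib norm_minus_commute)
    qed
    obtain M N where MN: "\<And>t x. t \<in> {T - a..T} \<Longrightarrow> \<bar>v t x\<bar> \<le> M" "\<And>t x. t \<in> {T - a..T} \<Longrightarrow> \<bar>w t x\<bar> \<le> N"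
      using Kv Kw unfolding K_space_def bounded_iff by fastforce
    show ?thesis
    proof (rule mild_comparison[where g = g and k = kk and L = L and ?s0.0 = "T - a" and T = T
          and z = "\<lambda>t x. w t x - v t x"])
      have "continuous_on ?D (\<lambda>(r, x). ?n r v x + (-1) * ?n r w x)"
        using cv(2) cw(2) unfolding case_prod_unfold by (intro continuous_intros)
      then show "continuous_on ?D (\<lambda>(r, x). g r x)"
        by (rule continuous_on_eq) (auto simp: g_def)
      show "g r \<in> bcontfun" if "r \<in> {T - a..T}" for r
        using that cv(4)[of r] cw(4)[of r] by (auto simp: g_def zero_bcontfun intro!: minus_cont)
      show "\<bar>g r x\<bar> \<le> kk r" if r: "r \<in> {T - a..T}" for r x
      proof (cases "r < T")
        case True
        then show ?thesis using cv(3)[of r x] cw(3)[of r x] r by (simp add: g_def kk_def)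
      next
        case False
        then show ?thesis using r L by (simp add: g_def kk_def)
      qed
      have "T - a \<le> T" using \<open>a > 0\<close> by simp
      then show "continuous_on {T - a..<T} kk" "kk integrable_on {T - a..T}"
        unfolding kk_def by (intro continuous_on_add integrable_add k; simp)+
      show "w t x - v t x = integral {t..T} (\<lambda>r. S (r - t) (g r) x)" if t: "t \<in> {T - a..T}" for t x
      proof -
        note mv = mild[OF v t cv(2,3,4), of x] and mw = mild[OF w t cw(2,3,4), of x]
        have "w t x - v t x = integral {t..T} (\<lambda>r. S (r - t) (?n r v) x) - integral {t..T} (\<lambda>r. S (r - t) (?n r w) x)"
          using mv mw by simp
        also have "\<dots> = integral {t..T} (\<lambda>r. S (r - t) (?n r v) x - S (r - t) (?n r w) x)"
          using mv mw by (simp add: integral_diff)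
        also have "\<dots> = integral {t..T} (\<lambda>r. S (r - t) (g r) x)"
          by (rule integral_spike[of "{T}"])
             (use t S_lincomb[OF cv(4) cw(4), where c = "-1"] in \<open>auto simp: g_def\<close>)
        finally show ?thesis .
      qed
      show "continuous_on ({T - a..T} \<times> UNIV) (\<lambda>(t, x). w t x - v t x)"
        using Kv Kw unfolding K_space_def case_prod_unfold by (auto intro!: continuous_intros)
      show "\<bar>w t x - v t x\<bar> \<le> M + N" if "t \<in> {T - a..T}" for t x
        using MN[OF that, of x] by linarith
      show "(\<lambda>x. w t x - v t x) differentiable at x" if "t \<in> {T - a..<T}" for t x
        using Kv Kw that by (auto simp: K_space_def intro!: differentiable_diff)
    qed (use cQ cB F(5) gw t in auto)
  qed
  show ?thesis
    using *[OF assms(13,14)] *[OF assms(14,13)] by (metis diff_le_0_iff_le order_antisym)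
qed

end
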